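(* Fix a privacy mechanism $Q\in\mathcal Q_\psi$. Let $w_{n,i}:\mathcal V_1\times\mathfrak X\times\mathfrak V\times\mathfrak X\times\mathcal T\to\mathbb R$, $i\in[n]$, be a triangular array of known nonrandom functions, let $\vartheta\in\mathcal T$, let $\check\vartheta$ be an estimator of $\vartheta$ computed from an i.i.d. sample $\bar{\mathcal S}'=((V_i',Z_i'))_{i\in[n]}$ from $P_{VZ}$, and define $$\bar w_{n,i}(v_1,x,v',z',\vartheta):=\big(Q_{\mathcal X}^{-1}[(v',x')\mapsto w_{n,i}(v_1,x,v',x',\vartheta)]\big)(v',z'),\qquad\check\theta(v_1,x):=\frac1n\sum_{i\in[n]}\bar w_{n,i}(v_1,x,V_i',Z_i',\check\vartheta).$$ Suppose that for a sequence of constants $(a_n)$, $$P_{VX}T_n^2=O_{P_{VZ}}(a_n^2),\qquad T_n(v_1,x):=\frac1n\sum_{i\in[n]}\big(\bar w_{n,i}(v_1,x,V_i',Z_i',\check\vartheta)-\bar w_{n,i}(v_1,x,V_i',Z_i',\vartheta)\big),\quad(v_1,x)\in\mathcal V_1\times\mathfrak X.$$ Let $\bar\sigma_i^2(v_1,x):=\mathrm{Var}\big[\bar w_{n,i}(v_1,x,V,Z,\vartheta)\big]$. Then for any $\theta\in L_2(P_{V_1X})$, $$P_{VX}(\check\theta-\theta)^2\le O_{P_{VZ}}(a_n^2)+O_{P_{VZ}}\Big(\frac1{n^2}\sum_{i\in[n]}\int\bar\sigma_i^2(v_1,x)\,dP_{V_1X}(v_1,x)\Big)+4\int\Big\{\frac1n\sum_{i\in[n]}P_{VX}[w_{n,i}(v_1,x,V,X,\vartheta)]-\theta(v_1,x)\Big\}^2dP_{V_1X}(v_1,x).$$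 Moreover, if $Q\in\mathcal Q_\delta$ with parameter $\alpha$, then for all $(i,v_1,x)\in[n]\times\mathcal V_1\times\mathfrak X$, $$\bar\sigma_i^2(v_1,x)\le\frac4{\alpha^2}\,\mathbb E\,w_{n,i}^2(v_1,x,V,Z,\vartheta).$$
   Context: $(V,X)$ has law $P_{VX}$ on a measurable space $\mathfrak V\times\mathfrak X$, $\mathfrak V$ a product space; $V_1$ is a collection of coordinates of $V$ with values in $\mathcal V_1$ and $P_{V_1X}$ is the law of $(V_1,X)$. $Ph=\int h\,dP$; for data-dependent functions, only the argument is integrated. $\mathcal T$ is an arbitrary set (space of a secondary nuisance parameter). A privacy mechanism is a Markov kernel $Q(B\mid x)$ from $\mathfrak X$ to a measurable space $\mathfrak Z$; given $(V,X)$, $Z\sim Q(\cdot\mid X)$, and $P_{VZ}$ is the law of $(V,Z)$: $P_{VZ}(B_v,B_z)=\int_{B_v}\int_{\mathfrak X}Q(B_z\mid x)dP_{VX}(v,x)$. $\mathcal Q_J^I$: $\mathfrak X=\{x_1,\dots,x_J\}$, $\mathfrak Z=\{z_1,\dots,z_J\}$ finite, $P_{VX}$ has a density w.r.t. $\nu_V\times$counting measure, and the matrix $Q$ with $(j,k)$ entry $Q(\{z_j\}\mid x_k)$ is invertible. $\mathcal Q_\delta$: $\mathfrak Z=\mathfrak X$ and $Q(B\mid x)=\alpha\delta_x(B)+(1-\alpha)\bar Q(B)$, $\alpha\in(0,1)$, $\bar Q$ a probability measure on $\mathfrak X$. $\mathcal Q_\psi=\mathcal Q_J^I\cup\mathcal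 Q_\delta$. $Q_{\mathcal X}^{-1}$ is the inverse of $(Q_{\mathcal X}k)(v,x)=\int k(v,z)Q(dz\mid x)$: for $Q\in\mathcal Q_J^I$, $((Q_{\mathcal X}^{-1}h)(v,z_j))_j=(Q^\top)^{-1}(h(v,x_j))_j$ as an operator on $L_2(P_{VX})$; for $Q\in\mathcal Q_\delta$, $(Q_{\mathcal X}^{-1}h)(v,z)=\frac1\alpha h(v,z)-\frac{1-\alpha}\alpha\int h(v,x)\bar Q(dx)$ for $h\in L_2(P_{VX})\cap L_2(P_V\otimes\bar Q)$. The functions $(v',x')\mapsto w_{n,i}(v_1,x,v',x',\vartheta)$ to which $Q_{\mathcal X}^{-1}$ is applied are implicitly assumed to be in its domain. $O_{P_{VZ}}$ is the stochastic order as $n\to\infty$ under sampling from $P_{VZ}$. *)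

theory Defs
  imports "HOL-Probability.Probability" "Jordan_Normal_Form.Gauss_Jordan_Elimination"
begin

definition L2 :: "'a measure \<Rightarrow> ('a \<Rightarrow> real) set" where
  "L2 M = {f \<in> borel_measurable M. integrable M (\<lambda>x. (f x)\<^sup>2)}"

(* The variance with values in [0,\<infinity>]; it is \<infinity> when the mean does not exist
   (prob_space.variance would be 0 for variables that are not square integrable). *)
definition ext_variance :: "'a measure \<Rightarrow> ('a \<Rightarrow> real) \<Rightarrow> ennreal" where
  "ext_variance M f =
     (if integrable M f
      then \<integral>\<^sup>+ y. ennreal ((f y - (\<integral>u. f u \<partial>M))\<^sup>2) \<partial>M
      else \<infinity>)"

(* R n = O_P(r n), where R n is a function of an observation with law P n.  The probability
   of exceedance is an outer probability (the least measure of an event that covers it), since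
   estimators with values in an arbitrary set come without a measurability requirement.
   For measurable R n this is the usual notion. *)
definition stoch_O ::
    "(nat \<Rightarrow> 's measure) \<Rightarrow> (nat \<Rightarrow> 's \<Rightarrow> ennreal) \<Rightarrow> (nat \<Rightarrow> ennreal) \<Rightarrow> bool" where
  "stoch_O P R r \<longleftrightarrow>
     (\<forall>\<epsilon>::real. \<epsilon> > 0 \<longrightarrow> (\<exists>C::real. C > 0 \<and> (\<forall>\<^sub>F n in sequentially.
        \<exists>A\<in>sets (P n). {s \<in> space (P n). ennreal C * r n < R n s} \<subseteq> A
                       \<and> emeasure (P n) A \<le> ennreal \<epsilon>)))"

(* VS, XS, ZS carry the sigma-algebras of the spaces of V, X and Z; PVX is the law of (V,X).
   X and Z have the same HOL type, because the second class of mechanisms requires the same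
   space for both; otherwise the spaces of XS and ZS are unrelated. *)

definition law_V :: "'v measure \<Rightarrow> ('v \<times> 'x) measure \<Rightarrow> 'v measure" where
  "law_V VS PVX = distr PVX VS fst"

definition law_VZ ::
    "'v measure \<Rightarrow> 'x measure \<Rightarrow> ('v \<times> 'x) measure \<Rightarrow> ('x \<Rightarrow> 'x measure) \<Rightarrow> ('v \<times> 'x) measure" where
  "law_VZ VS ZS PVX Q =
     PVX \<bind> (\<lambda>(v, x). distr (Q x) (VS \<Otimes>\<^sub>M ZS) (\<lambda>z. (v, z)))"

definition law_V1X ::
    "'l set \<Rightarrow> ('l \<Rightarrow> 'a measure) \<Rightarrow> 'x measure \<Rightarrow> (('l \<Rightarrow> 'a) \<times> 'x) measure
      \<Rightarrow> (('l \<Rightarrow> 'a) \<times> 'x) measure" where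
  "law_V1X K M XS PVX =
     distr PVX (PiM K M \<Otimes>\<^sub>M XS) (\<lambda>(v, x). (restrict v K, x))"

lemma emeasure_law_VZ_times:
  fixes VS :: "'v measure" and XS ZS :: "'x measure"
  assumes "sets PVX = sets (VS \<Otimes>\<^sub>M XS)" "space PVX \<noteq> {}"
    and Q: "Q \<in> XS \<rightarrow>\<^sub>M prob_algebra ZS"
    and B: "Bv \<in> sets VS" "Bz \<in> sets ZS"
  shows "emeasure (law_VZ VS ZS PVX Q) (Bv \<times> Bz) =
           (\<integral>\<^sup>+ (v, x). indicator Bv v * emeasure (Q x) Bz \<partial>PVX)"
proof -
  have sp: "space PVX = space VS \<times> space XS"
    using sets_eq_imp_space_eq[OF assms(1)] by (simp add: space_pair_measure)
  have Q': "Q \<in> XS \<rightarrow>\<^sub>M subprob_algebra ZS"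
    using Q by (rule measurable_prob_algebraD)
  have k: "(\<lambda>(v, x). distr (Q x) (VS \<Otimes>\<^sub>M ZS) (\<lambda>z. (v, z)))
      \<in> PVX \<rightarrow>\<^sub>M subprob_algebra (VS \<Otimes>\<^sub>M ZS)"
    unfolding measurable_cong_sets[OF assms(1) refl] case_prod_beta
    by (rule measurable_distr2[where M = ZS])
       (use Q' in \<open>auto intro: measurable_compose[OF measurable_snd]\<close>)
  have "emeasure (law_VZ VS ZS PVX Q) (Bv \<times> Bz) =
      (\<integral>\<^sup>+ p. emeasure ((\<lambda>(v, x). distr (Q x) (VS \<Otimes>\<^sub>M ZS) (\<lambda>z. (v, z))) p) (Bv \<times> Bz) \<partial>PVX)"
    unfolding law_VZ_def using B by (intro emeasure_bind[OF assms(2) k]) auto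
  also have "\<dots> = (\<integral>\<^sup>+ (v, x). indicator Bv v * emeasure (Q x) Bz \<partial>PVX)"
  proof (intro nn_integral_cong, clarsimp simp: sp)
    fix v x assume v: "v \<in> space VS" and x: "x \<in> space XS"
    have s: "sets (Q x) = sets ZS" using Q' x by (rule sets_kernel)
    have "emeasure (distr (Q x) (VS \<Otimes>\<^sub>M ZS) (Pair v)) (Bv \<times> Bz) =
        emeasure (Q x) (Pair v -` (Bv \<times> Bz) \<inter> space (Q x))"
      using v B s by (intro emeasure_distr) (auto simp: measurable_cong_sets[OF s refl])
    also have "Pair v -` (Bv \<times> Bz) \<inter> space (Q x) = (if v \<in> Bv then Bz else {})"
      using sets.sets_into_space[OF B(2)] sets_eq_imp_space_eq[OF s] by auto
    finally show "emeasure (distr (Q x) (VS \<Otimes>\<^sub>M ZS) (Pair v)) (Bv \<times> Bz) =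
        indicator Bv v * emeasure (Q x) Bz"
      by simp
  qed
  finally show ?thesis .
qed

(* In the finite case the J points of the two spaces are enumerated by xe and ze,
   indexed from 0 as in the matrix library. *)

definition mech_matrix :: "nat \<Rightarrow> (nat \<Rightarrow> 'x) \<Rightarrow> (nat \<Rightarrow> 'x) \<Rightarrow> ('x \<Rightarrow> 'x measure) \<Rightarrow> real mat" where
  "mech_matrix J xe ze Q = mat J J (\<lambda>(j, k). measure (Q (xe k)) {ze j})"

definition Q_fin ::
    "'v measure \<Rightarrow> nat \<Rightarrow> (nat \<Rightarrow> 'x) \<Rightarrow> (nat \<Rightarrow> 'x) \<Rightarrow> 'v measure \<Rightarrow> 'x measure \<Rightarrow> 'x measure
      \<Rightarrow> ('v \<times> 'x) measure \<Rightarrow> ('x \<Rightarrow> 'x measure) set" where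
  "Q_fin nuV J xe ze VS XS ZS PVX =
     {Q \<in> XS \<rightarrow>\<^sub>M prob_algebra ZS.
        bij_betw xe {..<J} (space XS) \<and> sets XS = Pow (space XS) \<and>
        bij_betw ze {..<J} (space ZS) \<and> sets ZS = Pow (space ZS) \<and>
        sigma_finite_measure nuV \<and> sets nuV = sets VS \<and>
        (\<exists>p \<in> borel_measurable (nuV \<Otimes>\<^sub>M count_space (space XS)).
           PVX = density (nuV \<Otimes>\<^sub>M count_space (space XS)) p) \<and>
        invertible_mat (mech_matrix J xe ze Q)}"

definition delta_mech ::
    "'x measure \<Rightarrow> 'x measure \<Rightarrow> ('x \<Rightarrow> 'x measure) \<Rightarrow> real \<Rightarrow> 'x measure \<Rightarrow> bool" where
  "delta_mech XS ZS Q \<alpha> Qbar \<longleftrightarrow>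
     sets ZS = sets XS \<and> 0 < \<alpha> \<and> \<alpha> < 1 \<and> prob_space Qbar \<and> sets Qbar = sets XS \<and>
     (\<forall>x\<in>space XS. \<forall>B\<in>sets XS.
        measure (Q x) B = \<alpha> * measure (return XS x) B + (1 - \<alpha>) * measure Qbar B)"

definition Q_delta :: "'x measure \<Rightarrow> 'x measure \<Rightarrow> ('x \<Rightarrow> 'x measure) set" where
  "Q_delta XS ZS = {Q \<in> XS \<rightarrow>\<^sub>M prob_algebra ZS. \<exists>\<alpha> Qbar. delta_mech XS ZS Q \<alpha> Qbar}"

definition Q_psi ::
    "'v measure \<Rightarrow> nat \<Rightarrow> (nat \<Rightarrow> 'x) \<Rightarrow> (nat \<Rightarrow> 'x) \<Rightarrow> 'v measure \<Rightarrow> 'x measure \<Rightarrow> 'x measure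
      \<Rightarrow> ('v \<times> 'x) measure \<Rightarrow> ('x \<Rightarrow> 'x measure) set" where
  "Q_psi nuV J xe ze VS XS ZS PVX = Q_fin nuV J xe ze VS XS ZS PVX \<union> Q_delta XS ZS"

definition fin_inverse ::
    "nat \<Rightarrow> (nat \<Rightarrow> 'x) \<Rightarrow> (nat \<Rightarrow> 'x) \<Rightarrow> ('x \<Rightarrow> 'x measure) \<Rightarrow> ('v \<times> 'x \<Rightarrow> real) \<Rightarrow> 'v \<times> 'x \<Rightarrow> real" where
  "fin_inverse J xe ze Q h = (\<lambda>(v, z).
     vec_index (the (mat_inverse (transpose_mat (mech_matrix J xe ze Q)))
                  *\<^sub>v Matrix.vec J (\<lambda>k. h (v, xe k)))
               (the_inv_into {..<J} ze z))"

definition delta_inverse ::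
    "real \<Rightarrow> 'x measure \<Rightarrow> ('v \<times> 'x \<Rightarrow> real) \<Rightarrow> 'v \<times> 'x \<Rightarrow> real" where
  "delta_inverse \<alpha> Qbar h = (\<lambda>(v, z).
     1 / \<alpha> * h (v, z) - (1 - \<alpha>) / \<alpha> * (\<integral>x. h (v, x) \<partial>Qbar))"

(* A mechanism of both classes has the same inverse by either formula.  The choice of
   (\<alpha>, Qbar) is immaterial as well: \<alpha> is unique unless every set in sets XS is
   empty or the whole space, and then h(v, .) is constant and delta_inverse leaves it fixed. *)
definition mech_inverse ::
    "nat \<Rightarrow> (nat \<Rightarrow> 'x) \<Rightarrow> (nat \<Rightarrow> 'x) \<Rightarrow> 'x measure \<Rightarrow> 'x measure \<Rightarrow> ('x \<Rightarrow> 'x measure)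
      \<Rightarrow> ('v \<times> 'x \<Rightarrow> real) \<Rightarrow> 'v \<times> 'x \<Rightarrow> real" where
  "mech_inverse J xe ze XS ZS Q =
     (if Q \<in> Q_delta XS ZS
      then case (SOME (\<alpha>, Qbar). delta_mech XS ZS Q \<alpha> Qbar) of
             (\<alpha>, Qbar) \<Rightarrow> delta_inverse \<alpha> Qbar
      else fin_inverse J xe ze Q)"

definition mech_inverse_dom ::
    "'v measure \<Rightarrow> nat \<Rightarrow> (nat \<Rightarrow> 'x) \<Rightarrow> (nat \<Rightarrow> 'x) \<Rightarrow> 'v measure \<Rightarrow> 'x measure \<Rightarrow> 'x measure
      \<Rightarrow> ('v \<times> 'x) measure \<Rightarrow> ('x \<Rightarrow> 'x measure) \<Rightarrow> ('v \<times> 'x \<Rightarrow> real) set" where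
  "mech_inverse_dom nuV J xe ze VS XS ZS PVX Q =
     {h \<in> L2 PVX.
        Q \<in> Q_fin nuV J xe ze VS XS ZS PVX \<or>
        (\<exists>\<alpha> Qbar. delta_mech XS ZS Q \<alpha> Qbar \<and> h \<in> L2 (law_V VS PVX \<Otimes>\<^sub>M Qbar))}"

(* In the remaining definitions Qinv stands for the inverse of the mechanism and
   s for the sample: s i is the i-th observation, 1 \<le> i \<le> n. *)

definition w_bar ::
    "(('v \<times> 'x \<Rightarrow> real) \<Rightarrow> 'v \<times> 'x \<Rightarrow> real)
      \<Rightarrow> (nat \<Rightarrow> nat \<Rightarrow> 'u \<Rightarrow> 'x \<Rightarrow> 'v \<Rightarrow> 'x \<Rightarrow> 't \<Rightarrow> real)
      \<Rightarrow> nat \<Rightarrow> nat \<Rightarrow> 'u \<Rightarrow> 'x \<Rightarrow> 'v \<Rightarrow> 'x \<Rightarrow> 't \<Rightarrow> real" where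
  "w_bar Qinv w n i v1 x v' z' t = Qinv (\<lambda>(v', x'). w n i v1 x v' x' t) (v', z')"

definition theta_check ::
    "(('v \<times> 'x \<Rightarrow> real) \<Rightarrow> 'v \<times> 'x \<Rightarrow> real)
      \<Rightarrow> (nat \<Rightarrow> nat \<Rightarrow> 'u \<Rightarrow> 'x \<Rightarrow> 'v \<Rightarrow> 'x \<Rightarrow> 't \<Rightarrow> real)
      \<Rightarrow> (nat \<Rightarrow> (nat \<Rightarrow> 'v \<times> 'x) \<Rightarrow> 't) \<Rightarrow> nat \<Rightarrow> (nat \<Rightarrow> 'v \<times> 'x) \<Rightarrow> 'u \<times> 'x \<Rightarrow> real" where
  "theta_check Qinv w est n s = (\<lambda>(v1, x).
     1 / real n * (\<Sum>i\<in>{1..n}. w_bar Qinv w n i v1 x (fst (s i)) (snd (s i)) (est n s)))"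

definition T_stat ::
    "(('v \<times> 'x \<Rightarrow> real) \<Rightarrow> 'v \<times> 'x \<Rightarrow> real)
      \<Rightarrow> (nat \<Rightarrow> nat \<Rightarrow> 'u \<Rightarrow> 'x \<Rightarrow> 'v \<Rightarrow> 'x \<Rightarrow> 't \<Rightarrow> real)
      \<Rightarrow> (nat \<Rightarrow> (nat \<Rightarrow> 'v \<times> 'x) \<Rightarrow> 't) \<Rightarrow> 't \<Rightarrow> nat \<Rightarrow> (nat \<Rightarrow> 'v \<times> 'x) \<Rightarrow> 'u \<times> 'x \<Rightarrow> real" where
  "T_stat Qinv w est t n s = (\<lambda>(v1, x).
     1 / real n * (\<Sum>i\<in>{1..n}. w_bar Qinv w n i v1 x (fst (s i)) (snd (s i)) (est n s)
                              - w_bar Qinv w n i v1 x (fst (s i)) (snd (s i)) t))"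

definition sigma_bar_sq ::
    "(('v \<times> 'x \<Rightarrow> real) \<Rightarrow> 'v \<times> 'x \<Rightarrow> real)
      \<Rightarrow> (nat \<Rightarrow> nat \<Rightarrow> 'u \<Rightarrow> 'x \<Rightarrow> 'v \<Rightarrow> 'x \<Rightarrow> 't \<Rightarrow> real)
      \<Rightarrow> ('v \<times> 'x) measure \<Rightarrow> 't \<Rightarrow> nat \<Rightarrow> nat \<Rightarrow> 'u \<times> 'x \<Rightarrow> ennreal" where
  "sigma_bar_sq Qinv w PVZ t n i = (\<lambda>(v1, x).
     ext_variance PVZ (\<lambda>(v, z). w_bar Qinv w n i v1 x v z t))"

end

(* Writing m_i(v1,x) for the P_VX-mean of w_i(v1,x,.,theta), the error of the estimator is
   T_n + D_n + b_n with D_n the centred sample mean of the wbar_i and b_n the average of the m_i minus theta,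
   and (T + D + b)^2 <= 2 T^2 + 4 D^2 + 4 b^2.  The mechanism maps wbar_i back to w_i, so m_i is
   also the P_VZ-mean of wbar_i; by Tonelli the expected integral of D_n^2 is then at most the
   average variance term, and Markov's inequality turns this into a stochastic order.  For a
   delta mechanism Q(.|x) dominates (1 - alpha) Qbar, so the second moment of the Qbar-integral
   in wbar_i is controlled by that of w_i. *)
theory Submission
  imports Defs
begin

subsection \<open>Variances and stochastic order\<close>

text \<open>The estimator \<open>est\<close> carries no measurability in the sample, so nothing
  containing it may be integrated over the sample. This dictates the splitting: T_n is passed on
  from the hypothesis as it is, while Tonelli and Markov touch only D_n, in which the parameter is
  the fixed \<open>\<tau>\<close>. Moments may be infinite or missing. \<open>ext_variance\<close>
  is infinite when the mean does not exist, so at every (v1,x) where some wbar_i is not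
  P_VZ-integrable the variance bound is void. The mean identity is therefore required only under
  integrability of wbar_i, and \<open>integral_mech_inverse\<close> has exactly such a premise. For
  delta mechanisms, \<open>mech_inverse\<close> works with one pair (\<open>\<alpha>\<close>,
  \<open>Qbar\<close>) picked by choice, whereas the bound 4/\<open>\<alpha>\<close>^2 is claimed
  for every pair that represents the mechanism. The weight is unique as soon as some measurable set
  separates two points; if none does, the inverse acts as the identity and the bound holds because 1
  <= 4/\<open>\<alpha>\<close>^2.\<close>

lemma (in prob_space) ext_variance_le:
  assumes [measurable]: "f \<in> borel_measurable M"
  shows "ext_variance M f \<le> (\<integral>\<^sup>+ y. ennreal ((f y)\<^sup>2) \<partial>M)"
proof (cases "(\<integral>\<^sup>+ y. ennreal ((f y)\<^sup>2) \<partial>M) = \<infinity>")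
  \<comment> \<open>A finite second moment on a probability space forces integrability, so the
    default value of \<open>ext_variance\<close> is met only where the right side is infinite
    too.\<close>
  case False
  then have sq: "integrable M (\<lambda>y. (f y)\<^sup>2)"
    by (auto simp: integrable_iff_bounded top.not_eq_extremum)
  then have f: "integrable M f"
    by (rule square_integrable_imp_integrable[rotated]) simp
  have "integrable M (\<lambda>y. (f y - expectation f)\<^sup>2)"
    using sq f by (simp add: power2_diff)
  then have "ext_variance M f = ennreal (variance f)"
    using f by (simp add: ext_variance_def nn_integral_eq_integral)
  also have "\<dots> \<le> ennreal (expectation (\<lambda>y. (f y)\<^sup>2))"
    by (intro ennreal_leI) (simp add: variance_eq[OF f sq])
  also have "\<dots> = (\<integral>\<^sup>+ y. ennreal ((f y)\<^sup>2) \<partial>M)"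
    using sq by (simp add: nn_integral_eq_integral)
  finally show ?thesis .
qed simp

text \<open>Nonnegativity of the variance. With an extended right side it also covers functions
  without a mean, whose Bochner integral is 0.\<close>

lemma (in prob_space) expectation_sq_le_nn_integral:
  assumes [measurable]: "f \<in> borel_measurable M"
  shows "ennreal ((expectation f)\<^sup>2) \<le> (\<integral>\<^sup>+ y. ennreal ((f y)\<^sup>2) \<partial>M)"
proof (cases "(\<integral>\<^sup>+ y. ennreal ((f y)\<^sup>2) \<partial>M) = \<infinity>")
  case False
  then have sq: "integrable M (\<lambda>y. (f y)\<^sup>2)"
    by (auto simp: integrable_iff_bounded top.not_eq_extremum)
  then have f: "integrable M f"
    by (rule square_integrable_imp_integrable[rotated]) simp
  have "0 \<le> variance f" by (rule integral_nonneg_AE) simp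
  then have "(expectation f)\<^sup>2 \<le> expectation (\<lambda>y. (f y)\<^sup>2)"
    by (simp add: variance_eq[OF f sq])
  then show ?thesis
    using sq by (simp add: nn_integral_eq_integral ennreal_leI)
qed simp

lemma (in sigma_finite_measure) borel_measurable_ext_variance:
  assumes f [measurable]: "(\<lambda>(y, z). f y z) \<in> borel_measurable (N \<Otimes>\<^sub>M M)"
  shows "(\<lambda>y. ext_variance M (f y)) \<in> borel_measurable N"
  unfolding ext_variance_def by measurable

text \<open>Coordinates under a product measure are independent, so a mixed term of the expanded
  square contains the mean of a centred factor and vanishes.\<close>

lemma nn_integral_PiM_sum_sq:
  fixes f :: "'i \<Rightarrow> 'a \<Rightarrow> real"
  assumes P: "prob_space P" and I: "finite I"
    and int: "\<And>i. i \<in> I \<Longrightarrow> integrable P (f i)"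
    and sq: "\<And>i. i \<in> I \<Longrightarrow> integrable P (\<lambda>z. (f i z)\<^sup>2)"
    and zero: "\<And>i. i \<in> I \<Longrightarrow> (\<integral>z. f i z \<partial>P) = 0"
  shows "(\<integral>\<^sup>+ s. ennreal ((\<Sum>i\<in>I. f i (s i))\<^sup>2) \<partial>PiM I (\<lambda>_. P)) =
         (\<Sum>i\<in>I. \<integral>\<^sup>+ z. ennreal ((f i z)\<^sup>2) \<partial>P)"
proof -
  interpret P: prob_space P by fact
  interpret PI: product_prob_space "\<lambda>_. P" I
    by (simp add: product_prob_space_def product_prob_space_axioms_def product_sigma_finite_def
        P.prob_space_axioms P.sigma_finite_measure_axioms)
  have [measurable]: "\<And>i. i \<in> I \<Longrightarrow> f i \<in> borel_measurable P"
    using int by (rule borel_measurable_integrable)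
  \<comment> \<open>\<open>g i j k\<close> is the factor of \<open>f i (s i) * f j (s j)\<close> at coordinate \<open>k\<close>;
    written as a product over all of \<open>I\<close>, the integral splits by independence.\<close>
  define g where "g i j k = (if i = j then (if k = i then \<lambda>z. (f i z)\<^sup>2 else (\<lambda>_. 1))
    else if k = i then f i else if k = j then f j else (\<lambda>_. 1))" for i j k
  have g: "f i (s i) * f j (s j) = (\<Prod>k\<in>I. g i j k (s k))" if ij: "i \<in> I" "j \<in> I" for i j s
  proof (cases "i = j")
    case True
    have "(\<Prod>k\<in>I. g i j k (s k)) = (\<Prod>k\<in>{i}. g i j k (s k))"
      using ij True I by (intro prod.mono_neutral_right) (auto simp: g_def)
    then show ?thesis using True by (simp add: g_def power2_eq_square)
  next
    case False
    have "(\<Prod>k\<in>I. g i j k (s k)) = (\<Prod>k\<in>{i, j}. g i j k (s k))"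
      using ij I False by (intro prod.mono_neutral_right) (auto simp: g_def)
    then show ?thesis using False by (auto simp: g_def)
  qed
  have gi: "integrable P (g i j k)" if "i \<in> I" "j \<in> I" for i j k
    using that int sq by (auto simp: g_def)
  have ints: "integrable (PiM I (\<lambda>_. P)) (\<lambda>s. f i (s i) * f j (s j))" if "i \<in> I" "j \<in> I" for i j
    unfolding g[OF that] by (intro PI.product_integrable_prod I gi that)
  have cross: "(\<integral>s. f i (s i) * f j (s j) \<partial>PiM I (\<lambda>_. P)) = (if i = j then (\<integral>z. (f i z)\<^sup>2 \<partial>P) else 0)"
    if ij: "i \<in> I" "j \<in> I" for i j
  proof -
    have "(\<integral>s. f i (s i) * f j (s j) \<partial>PiM I (\<lambda>_. P)) = (\<Prod>k\<in>I. \<integral>z. g i j k z \<partial>P)"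
      unfolding g[OF ij] by (intro PI.product_integral_prod I gi ij)
    also have "\<dots> = (if i = j then (\<integral>z. (f i z)\<^sup>2 \<partial>P) else 0)"
    proof (cases "i = j")
      case True
      have "(\<Prod>k\<in>I. \<integral>z. g i j k z \<partial>P) = (\<Prod>k\<in>{i}. \<integral>z. g i j k z \<partial>P)"
        using ij True I by (intro prod.mono_neutral_right) (auto simp: g_def P.prob_space)
      then show ?thesis using True by (simp add: g_def)
    next
      case False
      have "(\<integral>z. g i j i z \<partial>P) = 0" using False ij zero by (simp add: g_def)
      then show ?thesis using False ij I by (auto intro: prod_zero)
    qed
    finally show ?thesis .
  qed
  have exp: "(\<Sum>i\<in>I. f i (s i))\<^sup>2 = (\<Sum>i\<in>I. \<Sum>j\<in>I. f i (s i) * f j (s j))" for s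
    by (simp add: power2_eq_square sum_product)
  have "integrable (PiM I (\<lambda>_. P)) (\<lambda>s. (\<Sum>i\<in>I. f i (s i))\<^sup>2)"
    unfolding exp by (intro Bochner_Integration.integrable_sum ints)
  then have "(\<integral>\<^sup>+ s. ennreal ((\<Sum>i\<in>I. f i (s i))\<^sup>2) \<partial>PiM I (\<lambda>_. P)) =
      ennreal (\<integral>s. (\<Sum>i\<in>I. f i (s i))\<^sup>2 \<partial>PiM I (\<lambda>_. P))"
    by (simp add: nn_integral_eq_integral)
  also have "(\<integral>s. (\<Sum>i\<in>I. f i (s i))\<^sup>2 \<partial>PiM I (\<lambda>_. P)) =
      (\<Sum>i\<in>I. \<Sum>j\<in>I. \<integral>s. f i (s i) * f j (s j) \<partial>PiM I (\<lambda>_. P))"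
    unfolding exp
    by (subst Bochner_Integration.integral_sum)
       (auto intro!: sum.cong Bochner_Integration.integral_sum ints)
  also have "\<dots> = (\<Sum>i\<in>I. \<integral>z. (f i z)\<^sup>2 \<partial>P)"
    using I by (intro sum.cong refl) (simp add: cross cong: sum.cong)
  also have "ennreal \<dots> = (\<Sum>i\<in>I. \<integral>\<^sup>+ z. ennreal ((f i z)\<^sup>2) \<partial>P)"
    by (subst sum_ennreal[symmetric])
       (auto intro!: sum.cong simp: nn_integral_eq_integral[OF sq])
  finally show ?thesis .
qed

lemma nn_integral_PiM_mean_deviation_sq_le:
  fixes f :: "nat \<Rightarrow> 'a \<Rightarrow> real"
  assumes P: "prob_space P"
    and f: "\<And>i. i \<in> {1..n} \<Longrightarrow> f i \<in> borel_measurable P"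
    and m: "\<And>i. i \<in> {1..n} \<Longrightarrow> integrable P (f i) \<Longrightarrow> (\<integral>z. f i z \<partial>P) = m i"
  shows "(\<integral>\<^sup>+ s. ennreal ((1 / real n * (\<Sum>i\<in>{1..n}. f i (s i) - m i))\<^sup>2) \<partial>PiM {1..n} (\<lambda>_. P))
       \<le> ennreal (1 / (real n)\<^sup>2) * (\<Sum>i\<in>{1..n}. ext_variance P (f i))"
\<comment> \<open>If some variance is infinite, so is the right side, because 1/n^2 is positive.
  Otherwise every \<open>f i\<close> is integrable with mean \<open>m i\<close>, and the bound is an
  equality.\<close>
proof (cases "n = 0 \<or> (\<Sum>i\<in>{1..n}. ext_variance P (f i)) = \<infinity>")
  case True
  then show ?thesis
  proof
    assume top: "(\<Sum>i\<in>{1..n}. ext_variance P (f i)) = \<infinity>"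
    then have "n \<noteq> 0" by (intro notI) simp
    then show ?thesis unfolding top by (simp add: ennreal_mult_top)
  qed simp
next
  case False
  interpret P: prob_space P by fact
  note f [measurable]
  from False have fin: "ext_variance P (f i) < \<infinity>" if "i \<in> {1..n}" for i
    using that by (auto simp: less_top)
  have int: "integrable P (f i)" if "i \<in> {1..n}" for i
    using fin[OF that] by (auto simp: ext_variance_def split: if_splits)
  have ev: "ext_variance P (f i) = (\<integral>\<^sup>+ z. ennreal ((f i z - m i)\<^sup>2) \<partial>P)" if "i \<in> {1..n}" for i
    using int[OF that] m[OF that int[OF that]] by (simp add: ext_variance_def)
  have sq: "integrable P (\<lambda>z. (f i z - m i)\<^sup>2)" if "i \<in> {1..n}" for i
    using fin[OF that] f[OF that] unfolding ev[OF that] by (auto simp: integrable_iff_bounded)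
  have "(\<integral>\<^sup>+ s. ennreal ((1 / real n * (\<Sum>i\<in>{1..n}. f i (s i) - m i))\<^sup>2) \<partial>PiM {1..n} (\<lambda>_. P))
      = (\<integral>\<^sup>+ s. ennreal (1 / (real n)\<^sup>2) * ennreal ((\<Sum>i\<in>{1..n}. f i (s i) - m i)\<^sup>2) \<partial>PiM {1..n} (\<lambda>_. P))"
    by (intro nn_integral_cong) (simp add: ennreal_mult[symmetric] power_divide)
  also have "\<dots> = ennreal (1 / (real n)\<^sup>2) *
      (\<integral>\<^sup>+ s. ennreal ((\<Sum>i\<in>{1..n}. f i (s i) - m i)\<^sup>2) \<partial>PiM {1..n} (\<lambda>_. P))"
    by (intro nn_integral_cmult) measurable
  also have "(\<integral>\<^sup>+ s. ennreal ((\<Sum>i\<in>{1..n}. f i (s i) - m i)\<^sup>2) \<partial>PiM {1..n} (\<lambda>_. P)) =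
      (\<Sum>i\<in>{1..n}. \<integral>\<^sup>+ z. ennreal ((f i z - m i)\<^sup>2) \<partial>P)"
    using int m by (intro nn_integral_PiM_sum_sq[OF P, where f = "\<lambda>i z. f i z - m i"] sq)
                   (auto simp: P.prob_space)
  finally show ?thesis by (simp add: ev)
qed

section \<open>Rules for stochastic orders\<close>

lemma stoch_O_cmult:
  assumes R: "stoch_O P R r" and c: "0 < c"
  shows "stoch_O P (\<lambda>n s. ennreal c * R n s) r"
  unfolding stoch_O_def
proof (intro allI impI)
  fix \<epsilon> :: real assume "\<epsilon> > 0"
  with R obtain C where C: "C > 0" and ev: "\<forall>\<^sub>F n in sequentially.
      \<exists>A\<in>sets (P n). {s \<in> space (P n). ennreal C * r n < R n s} \<subseteq> A \<and> emeasure (P n) A \<le> ennreal \<epsilon>"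
    unfolding stoch_O_def by blast
  \<comment> \<open>Contraposition turns the cancellation of \<open>ennreal c\<close> into
    monotonicity of multiplication, which is also safe for infinite values.\<close>
  have "ennreal C * r n < R n s" if "ennreal (c * C) * r n < ennreal c * R n s" for n s
  proof (rule ccontr)
    assume "\<not> ennreal C * r n < R n s"
    then have "ennreal c * R n s \<le> ennreal c * (ennreal C * r n)"
      by (intro mult_left_mono) auto
    then show False using that c C by (simp add: ennreal_mult mult.assoc)
  qed
  then have "{s \<in> space (P n). ennreal (c * C) * r n < ennreal c * R n s}
      \<subseteq> {s \<in> space (P n). ennreal C * r n < R n s}" for n
    by blast
  then show "\<exists>C>0. \<forall>\<^sub>F n in sequentially. \<exists>A\<in>sets (P n).
      {s \<in> space (P n). ennreal C * r n < ennreal c * R n s} \<subseteq> A \<and> emeasure (P n) A \<le> ennreal \<epsilon>"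
    using c C by (intro exI[of _ "c * C"] conjI eventually_mono[OF ev]) (simp, meson order_trans)
qed

text \<open>Markov's inequality, uniformly in \<open>n\<close>: the scale \<open>r n\<close> cancels
  between the expectation and the threshold. The exceedance set is measurable here and serves as its
  own cover.\<close>

lemma stoch_O_of_nn_integral_le:
  assumes R [measurable]: "\<And>n. R n \<in> borel_measurable (P n)"
    and le: "\<And>n. (\<integral>\<^sup>+ s. R n s \<partial>P n) \<le> ennreal c * r n" and c: "0 < c"
  shows "stoch_O P R r"
  unfolding stoch_O_def
proof (intro allI impI)
  fix \<epsilon> :: real assume \<epsilon>: "\<epsilon> > 0"
  \<comment> \<open>Markov bounds the probability of exceedance by
    \<open>c * r n / (C * r n)\<close>, which equals \<open>\<epsilon>\<close> for this
    choice.\<close>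
  define C where "C = c / \<epsilon>"
  have C: "C > 0" using c \<epsilon> by (simp add: C_def)
  have c_eq: "ennreal c = ennreal C * ennreal \<epsilon>"
    using c \<epsilon> by (simp add: C_def flip: ennreal_mult)
  have "emeasure (P n) {s \<in> space (P n). ennreal C * r n < R n s} \<le> ennreal \<epsilon>" for n
  proof -
    \<comment> \<open>The threshold can be divided out only if it is neither 0 nor infinite. At 0
      the variable vanishes almost everywhere; at infinity nothing exceeds the threshold.\<close>
    consider "r n = 0" | "r n = \<infinity>" | "r n \<noteq> 0" "r n \<noteq> \<infinity>" by blast
    then show ?thesis
    proof cases
      case 1
      with le[of n] have "AE s in P n. R n s = 0"
        by (simp add: nn_integral_0_iff_AE)
      then have "AE s in P n. \<not> ennreal C * r n < R n s"
        by eventually_elim simp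
      then have "emeasure (P n) {s \<in> space (P n). ennreal C * r n < R n s} = 0"
        by (subst (asm) AE_iff_measurable[OF _ refl]) auto
      then show ?thesis by simp
    next
      case 2
      then show ?thesis using C by (simp add: ennreal_mult_top)
    next
      case 3
      let ?t = "ennreal C * r n"
      have t: "?t \<noteq> 0" "?t \<noteq> \<infinity>" using 3 C by (auto simp: ennreal_mult_eq_top_iff)
      have "?t * emeasure (P n) {s \<in> space (P n). ?t < R n s}
          = (\<integral>\<^sup>+ s. ?t * indicator {s \<in> space (P n). ?t < R n s} s \<partial>P n)"
        by (subst nn_integral_cmult_indicator) auto
      also have "\<dots> \<le> (\<integral>\<^sup>+ s. R n s \<partial>P n)"
        by (intro nn_integral_mono) (auto simp: indicator_def)
      also have "\<dots> \<le> ennreal c * r n" by (rule le)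
      also have "\<dots> = ?t * ennreal \<epsilon>"
        unfolding c_eq by (simp add: mult_ac)
      finally show ?thesis
        using t by (simp add: ennreal_mult_le_mult_iff)
    qed
  qed
  then show "\<exists>C>0. \<forall>\<^sub>F n in sequentially. \<exists>A\<in>sets (P n).
      {s \<in> space (P n). ennreal C * r n < R n s} \<subseteq> A \<and> emeasure (P n) A \<le> ennreal \<epsilon>"
    using C
    by (intro exI[of _ C] conjI always_eventually allI bexI[of _ "{s \<in> space (P n). ennreal C * r n < R n s}" for n]) auto
qed

lemma stoch_O_integrated_mean_deviation_sq:
  fixes f :: "nat \<Rightarrow> nat \<Rightarrow> 'y \<Rightarrow> 'a \<Rightarrow> real"
  assumes P: "prob_space P" and Y: "sigma_finite_measure Y"
    and f [measurable]: "\<And>n i. i \<in> {1..n} \<Longrightarrow> (\<lambda>(y, z). f n i y z) \<in> borel_measurable (Y \<Otimes>\<^sub>M P)"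
    and m [measurable]: "\<And>n i. i \<in> {1..n} \<Longrightarrow> m n i \<in> borel_measurable Y"
    and mean: "\<And>n i y. i \<in> {1..n} \<Longrightarrow> y \<in> space Y \<Longrightarrow> integrable P (f n i y) \<Longrightarrow>
      (\<integral>z. f n i y z \<partial>P) = m n i y"
  shows "stoch_O (\<lambda>n. PiM {1..n} (\<lambda>_. P))
    (\<lambda>n s. \<integral>\<^sup>+ y. ennreal ((1 / real n * (\<Sum>i\<in>{1..n}. f n i y (s i) - m n i y))\<^sup>2) \<partial>Y)
    (\<lambda>n. ennreal (1 / (real n)\<^sup>2) * (\<Sum>i\<in>{1..n}. \<integral>\<^sup>+ y. ext_variance P (f n i y) \<partial>Y))"
proof (rule stoch_O_of_nn_integral_le[where c = 1])
  fix n :: nat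
  interpret P: prob_space P by fact
  interpret Y: sigma_finite_measure Y by fact
  interpret PI: prob_space "PiM {1..n} (\<lambda>_. P)" by (rule prob_space_PiM) (rule P)
  interpret YPI: pair_sigma_finite Y "PiM {1..n} (\<lambda>_. P)" ..
  let ?g = "\<lambda>y s. ennreal ((1 / real n * (\<Sum>i\<in>{1..n}. f n i y (s i) - m n i y))\<^sup>2)"
  \<comment> \<open>Evaluating the sample at a coordinate is measurable, so joint measurability in
    \<open>y\<close> and one observation lifts to \<open>y\<close> and the whole sample, as Tonelli
    demands.\<close>
  have fs: "(\<lambda>x. f n i (fst x) (snd x i)) \<in> borel_measurable (Y \<Otimes>\<^sub>M PiM {1..n} (\<lambda>_. P))"
    if i: "i \<in> {1..n}" for i
  proof -
    have "(\<lambda>x. (fst x, snd x i)) \<in> Y \<Otimes>\<^sub>M PiM {1..n} (\<lambda>_. P) \<rightarrow>\<^sub>M Y \<Otimes>\<^sub>M P"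
      using i by measurable
    from measurable_compose[OF this f[OF i]] show ?thesis by simp
  qed
  have ms: "(\<lambda>x. m n i (fst x)) \<in> borel_measurable (Y \<Otimes>\<^sub>M PiM {1..n} (\<lambda>_. P))" if "i \<in> {1..n}" for i
    by (rule measurable_compose[OF measurable_fst m[OF that]])
  have g: "(\<lambda>(y, s). ?g y s) \<in> borel_measurable (Y \<Otimes>\<^sub>M PiM {1..n} (\<lambda>_. P))"
    unfolding case_prod_beta
    by (intro measurable_compose[OF _ measurable_ennreal] borel_measurable_power
        borel_measurable_times borel_measurable_const borel_measurable_sum borel_measurable_diff fs ms)
  have g': "(\<lambda>(s, y). ?g y s) \<in> borel_measurable (PiM {1..n} (\<lambda>_. P) \<Otimes>\<^sub>M Y)"
    using measurable_compose[OF measurable_pair_swap' g] by (simp add: case_prod_beta)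
  show "(\<lambda>s. \<integral>\<^sup>+ y. ?g y s \<partial>Y) \<in> borel_measurable (PiM {1..n} (\<lambda>_. P))"
    by (rule Y.borel_measurable_nn_integral[OF g'])
  have fy: "f n i y \<in> borel_measurable P" if "i \<in> {1..n}" "y \<in> space Y" for i y
    using measurable_compose[OF measurable_Pair1'[OF that(2)] f[OF that(1)]] by simp
  have "(\<integral>\<^sup>+ s. \<integral>\<^sup>+ y. ?g y s \<partial>Y \<partial>PiM {1..n} (\<lambda>_. P)) =
      (\<integral>\<^sup>+ y. \<integral>\<^sup>+ s. ?g y s \<partial>PiM {1..n} (\<lambda>_. P) \<partial>Y)"
    by (rule YPI.Fubini'[OF g])
  also have "\<dots> \<le> (\<integral>\<^sup>+ y. ennreal (1 / (real n)\<^sup>2) * (\<Sum>i\<in>{1..n}. ext_variance P (f n i y)) \<partial>Y)"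
    by (intro nn_integral_mono nn_integral_PiM_mean_deviation_sq_le[OF P] fy mean)
  also have "\<dots> = ennreal (1 / (real n)\<^sup>2) * (\<Sum>i\<in>{1..n}. \<integral>\<^sup>+ y. ext_variance P (f n i y) \<partial>Y)"
    by (subst nn_integral_cmult, rule borel_measurable_sum, erule P.borel_measurable_ext_variance[OF f])
       (subst nn_integral_sum, erule P.borel_measurable_ext_variance[OF f], rule refl)
  finally show "(\<integral>\<^sup>+ s. \<integral>\<^sup>+ y. ?g y s \<partial>Y \<partial>PiM {1..n} (\<lambda>_. P)) \<le>
      ennreal 1 * (ennreal (1 / (real n)\<^sup>2) * (\<Sum>i\<in>{1..n}. \<integral>\<^sup>+ y. ext_variance P (f n i y) \<partial>Y))"
    by simp
qed simp

lemma nn_integral_sum3_sq_le: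
  fixes f g h :: "'a \<Rightarrow> real"
  assumes [measurable]: "f \<in> borel_measurable M" "g \<in> borel_measurable M" "h \<in> borel_measurable M"
  shows "(\<integral>\<^sup>+ y. ennreal ((f y + g y + h y)\<^sup>2) \<partial>M) \<le>
    2 * (\<integral>\<^sup>+ y. ennreal ((f y)\<^sup>2) \<partial>M) + 4 * (\<integral>\<^sup>+ y. ennreal ((g y)\<^sup>2) \<partial>M)
      + 4 * (\<integral>\<^sup>+ y. ennreal ((h y)\<^sup>2) \<partial>M)"
proof -
  \<comment> \<open>The uneven constants come from separating \<open>a\<close> from
    \<open>b + c\<close> first and \<open>b\<close> from \<open>c\<close> afterwards, with a factor
    2 each time. The last 4 is the one in front of the squared bias; the other two are absorbed by
    the stochastic orders.\<close>
  have "(a + b + c)\<^sup>2 \<le> 2 * a\<^sup>2 + 4 * b\<^sup>2 + 4 * c\<^sup>2" for a b c :: real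
    using zero_le_power2[of "a - (b + c)"] zero_le_power2[of "b - c"]
    by (simp add: power2_eq_square algebra_simps)
  then have "ennreal ((f y + g y + h y)\<^sup>2) \<le>
      2 * ennreal ((f y)\<^sup>2) + 4 * ennreal ((g y)\<^sup>2) + 4 * ennreal ((h y)\<^sup>2)" for y
    by (simp add: ennreal_mult'' flip: ennreal_numeral ennreal_plus ennreal_mult'')
  then have "(\<integral>\<^sup>+ y. ennreal ((f y + g y + h y)\<^sup>2) \<partial>M) \<le>
      (\<integral>\<^sup>+ y. 2 * ennreal ((f y)\<^sup>2) + 4 * ennreal ((g y)\<^sup>2) + 4 * ennreal ((h y)\<^sup>2) \<partial>M)"
    by (intro nn_integral_mono)
  then show ?thesis
    by (simp add: nn_integral_add nn_integral_cmult)
qed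

subsection \<open>The privatized law\<close>

text \<open>Positive and negative part are handled by the bind formula for nonnegative functions.
  Integrability under the mixture makes both total integrals finite, so both parts are finite for
  almost every \<open>x\<close> and may be subtracted.\<close>

lemma
  fixes f :: "'b \<Rightarrow> real"
  assumes N [measurable]: "N \<in> M \<rightarrow>\<^sub>M subprob_algebra B"
    and f: "integrable (M \<bind> N) f" and fB [measurable]: "f \<in> borel_measurable B"
  shows AE_integrable_bind: "AE x in M. integrable (N x) f"
    and integral_bind_iterated: "(\<integral>y. f y \<partial>(M \<bind> N)) = (\<integral>x. (\<integral>y. f y \<partial>N x) \<partial>M)"
proof -
  define p where "p x = (\<integral>\<^sup>+ y. ennreal (f y) \<partial>N x)" for x
  define q where "q x = (\<integral>\<^sup>+ y. ennreal (- f y) \<partial>N x)" for x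
  have [measurable]: "p \<in> borel_measurable M" "q \<in> borel_measurable M"
    unfolding p_def q_def
    by (auto intro!: measurable_compose[OF N] nn_integral_measurable_subprob_algebra)
  have fN: "f \<in> borel_measurable (N x)" if "x \<in> space M" for x
    using fB measurable_cong_sets[OF sets_kernel[OF N that] refl] by blast
  have P: "(\<integral>\<^sup>+ y. ennreal (f y) \<partial>(M \<bind> N)) = (\<integral>\<^sup>+ x. p x \<partial>M)"
    and Q: "(\<integral>\<^sup>+ y. ennreal (- f y) \<partial>(M \<bind> N)) = (\<integral>\<^sup>+ x. q x \<partial>M)"
    unfolding p_def q_def by (auto intro!: nn_integral_bind[OF _ N])
  have pq: "(\<integral>\<^sup>+ x. p x \<partial>M) \<noteq> \<infinity>" "(\<integral>\<^sup>+ x. q x \<partial>M) \<noteq> \<infinity>"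
    using f unfolding P[symmetric] Q[symmetric] by (auto simp: real_integrable_def)
  then have ae: "AE x in M. p x \<noteq> \<infinity>" "AE x in M. q x \<noteq> \<infinity>"
    by - (rule nn_integral_noteq_infinite, measurable)+
  from ae AE_space show int: "AE x in M. integrable (N x) f"
    by eventually_elim (auto simp: real_integrable_def p_def q_def fN)
  \<comment> \<open>\<open>enn2real\<close> sends infinity to 0, which by \<open>ae\<close> alters
    the integrands only on a null set.\<close>
  have e: "(\<integral>\<^sup>+ x. ennreal (enn2real (p x)) \<partial>M) = (\<integral>\<^sup>+ x. p x \<partial>M)"
    "(\<integral>\<^sup>+ x. ennreal (enn2real (q x)) \<partial>M) = (\<integral>\<^sup>+ x. q x \<partial>M)"
    using ae by (auto intro!: nn_integral_cong_AE simp: less_top)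
  have i: "integrable M (\<lambda>x. enn2real (p x))" "integrable M (\<lambda>x. enn2real (q x))"
    using pq by (auto simp: integrable_iff_bounded e less_top)
  have "(\<integral>y. f y \<partial>(M \<bind> N)) = enn2real (\<integral>\<^sup>+ x. p x \<partial>M) - enn2real (\<integral>\<^sup>+ x. q x \<partial>M)"
    using f by (simp add: real_lebesgue_integral_def P Q)
  also have "\<dots> = (\<integral>x. enn2real (p x) \<partial>M) - (\<integral>x. enn2real (q x) \<partial>M)"
    by (simp add: integral_eq_nn_integral e)
  also have "\<dots> = (\<integral>x. enn2real (p x) - enn2real (q x) \<partial>M)"
    using i by simp
  also have "\<dots> = (\<integral>x. (\<integral>y. f y \<partial>N x) \<partial>M)"
  proof (rule integral_cong_AE)
    show "(\<lambda>x. \<integral>y. f y \<partial>N x) \<in> borel_measurable M"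
      by (rule measurable_compose[OF N integral_measurable_subprob_algebra[OF fB]])
    from int show "AE x in M. enn2real (p x) - enn2real (q x) = (\<integral>y. f y \<partial>N x)"
      by eventually_elim (simp add: real_lebesgue_integral_def p_def q_def)
  qed measurable
  finally show "(\<integral>y. f y \<partial>(M \<bind> N)) = (\<integral>x. (\<integral>y. f y \<partial>N x) \<partial>M)" .
qed

locale privatized_law =
  fixes VS :: "'v measure" and XS ZS :: "'x measure" and PVX :: "('v \<times> 'x) measure"
    and Q :: "'x \<Rightarrow> 'x measure"
  assumes prob_PVX: "prob_space PVX"
    and sets_PVX [measurable_cong]: "sets PVX = sets (VS \<Otimes>\<^sub>M XS)"
    and mechanism: "Q \<in> XS \<rightarrow>\<^sub>M prob_algebra ZS"
begin

abbreviation PVZ :: "('v \<times> 'x) measure" where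
  "PVZ \<equiv> law_VZ VS ZS PVX Q"

lemma space_PVX: "space PVX = space VS \<times> space XS"
  using sets_eq_imp_space_eq[OF sets_PVX] by (simp add: space_pair_measure)

lemma measurable_mechanism [measurable]: "Q \<in> XS \<rightarrow>\<^sub>M subprob_algebra ZS"
  using mechanism by (rule measurable_prob_algebraD)

lemma sets_mechanism: "x \<in> space XS \<Longrightarrow> sets (Q x) = sets ZS"
  by (rule sets_kernel[OF measurable_mechanism])

lemma prob_space_mechanism: "x \<in> space XS \<Longrightarrow> prob_space (Q x)"
  using measurable_space[OF mechanism] by (auto simp: space_prob_algebra)

lemma measurable_law_VZ_kernel:
  "(\<lambda>(v, x). distr (Q x) (VS \<Otimes>\<^sub>M ZS) (\<lambda>z. (v, z))) \<in> PVX \<rightarrow>\<^sub>M subprob_algebra (VS \<Otimes>\<^sub>M ZS)"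
  unfolding measurable_cong_sets[OF sets_PVX refl] case_prod_beta
  by (rule measurable_distr2[where M = ZS])
     (auto intro: measurable_compose[OF measurable_snd])

lemma measurable_Pair_mechanism:
  assumes "v \<in> space VS" "x \<in> space XS"
  shows "(\<lambda>z. (v, z)) \<in> Q x \<rightarrow>\<^sub>M VS \<Otimes>\<^sub>M ZS"
  using assms by (simp add: measurable_cong_sets[OF sets_mechanism refl])

lemma sets_PVZ [measurable_cong]: "sets PVZ = sets (VS \<Otimes>\<^sub>M ZS)"
  unfolding law_VZ_def
  using sets_kernel[OF measurable_law_VZ_kernel] prob_space.not_empty[OF prob_PVX]
  by (rule sets_bind)

lemma space_PVZ: "space PVZ = space VS \<times> space ZS"
  using sets_eq_imp_space_eq[OF sets_PVZ] by (simp add: space_pair_measure)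

lemma prob_space_PVZ: "prob_space PVZ"
  unfolding law_VZ_def
proof (rule prob_space.prob_space_bind[OF prob_PVX _ measurable_law_VZ_kernel], rule AE_I2)
  fix p assume "p \<in> space PVX"
  then show "prob_space (case p of (v, x) \<Rightarrow> distr (Q x) (VS \<Otimes>\<^sub>M ZS) (\<lambda>z. (v, z)))"
    by (auto simp: space_PVX intro!: prob_space.prob_space_distr prob_space_mechanism
        measurable_Pair_mechanism)
qed

lemma nn_integral_PVZ:
  assumes [measurable]: "f \<in> borel_measurable (VS \<Otimes>\<^sub>M ZS)"
  shows "(\<integral>\<^sup>+ p. f p \<partial>PVZ) = (\<integral>\<^sup>+ (v, x). (\<integral>\<^sup>+ z. f (v, z) \<partial>Q x) \<partial>PVX)"
  unfolding law_VZ_def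
  by (subst nn_integral_bind[OF _ measurable_law_VZ_kernel])
     (auto simp: space_PVX nn_integral_distr measurable_Pair_mechanism intro!: nn_integral_cong)

text \<open>The identity for the inner integrals is only required where these exist. An inverse mechanism
  satisfies it there without any domain condition, so integrability of \<open>f\<close> is enough.\<close>

lemma integral_PVZ:
  fixes f :: "'v \<times> 'x \<Rightarrow> real"
  assumes f: "integrable PVZ f"
    and h [measurable]: "h \<in> borel_measurable PVX"
    and inner: "\<And>v x. v \<in> space VS \<Longrightarrow> x \<in> space XS \<Longrightarrow> integrable (Q x) (\<lambda>z. f (v, z)) \<Longrightarrow>
      (\<integral>z. f (v, z) \<partial>Q x) = h (v, x)"
  shows "(\<integral>p. f p \<partial>PVZ) = (\<integral>p. h p \<partial>PVX)"
proof -
  let ?N = "\<lambda>(v, x). distr (Q x) (VS \<Otimes>\<^sub>M ZS) (\<lambda>z. (v, z))"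
  have fm: "f \<in> borel_measurable (VS \<Otimes>\<^sub>M ZS)"
    using borel_measurable_integrable[OF f] measurable_cong_sets[OF sets_PVZ refl] by blast
  note f' = f[unfolded law_VZ_def]
  have ae: "AE p in PVX. (\<integral>z. f z \<partial>?N p) = h p"
    using AE_integrable_bind[OF measurable_law_VZ_kernel f' fm] AE_space
  proof eventually_elim
    case (elim p)
    then obtain v x where p: "p = (v, x)" "v \<in> space VS" "x \<in> space XS"
      by (auto simp: space_PVX)
    note [simp] = integral_distr[OF measurable_Pair_mechanism[OF p(2,3)] fm]
      integrable_distr_eq[OF measurable_Pair_mechanism[OF p(2,3)] fm]
    from elim inner[OF p(2,3)] show ?case by (simp add: p(1))
  qed
  have "(\<integral>p. f p \<partial>PVZ) = (\<integral>p. (\<integral>z. f z \<partial>?N p) \<partial>PVX)"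
    unfolding law_VZ_def by (rule integral_bind_iterated[OF measurable_law_VZ_kernel f' fm])
  also have "\<dots> = (\<integral>p. h p \<partial>PVX)"
    by (rule integral_cong_AE[OF measurable_compose[OF measurable_law_VZ_kernel
            integral_measurable_subprob_algebra[OF fm]] h ae])
  finally show ?thesis .
qed

end

section \<open>Delta mechanisms as mixtures of a point mass and \<open>Qbar\<close>\<close>

context
  fixes XS ZS :: "'x measure" and Q :: "'x \<Rightarrow> 'x measure" and \<alpha> :: real and Qbar :: "'x measure"
  assumes mech: "Q \<in> XS \<rightarrow>\<^sub>M prob_algebra ZS" and delta: "delta_mech XS ZS Q \<alpha> Qbar"
begin

lemma delta_mechD:
  shows "sets ZS = sets XS" "0 < \<alpha>" "\<alpha> < 1" "prob_space Qbar" "sets Qbar = sets XS"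
    and "x \<in> space XS \<Longrightarrow> B \<in> sets XS \<Longrightarrow>
      measure (Q x) B = \<alpha> * indicator B x + (1 - \<alpha>) * measure Qbar B"
  using delta by (auto simp: delta_mech_def measure_return)

lemma sets_delta_mech:
  assumes "x \<in> space XS" shows "sets (Q x) = sets XS"
  using measurable_space[OF mech assms] delta_mechD(1) by (auto simp: space_prob_algebra)

lemma emeasure_delta_mech:
  assumes x: "x \<in> space XS" and B: "B \<in> sets XS"
  shows "emeasure (Q x) B = ennreal \<alpha> * indicator B x + ennreal (1 - \<alpha>) * emeasure Qbar B"
proof -
  interpret Qx: prob_space "Q x"
    using measurable_space[OF mech x] by (auto simp: space_prob_algebra)
  interpret Qbar: prob_space Qbar by (rule delta_mechD)
  show ?thesis
    using delta_mechD(2,3)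
    by (simp add: Qx.emeasure_eq_measure Qbar.emeasure_eq_measure delta_mechD(6)[OF x B]
        ennreal_mult split: split_indicator)
qed

lemma nn_integral_delta_mech:
  assumes x: "x \<in> space XS" and f: "f \<in> borel_measurable XS"
  shows "(\<integral>\<^sup>+ z. f z \<partial>Q x) = ennreal \<alpha> * f x + ennreal (1 - \<alpha>) * (\<integral>\<^sup>+ z. f z \<partial>Qbar)"
  using f
proof induct
  note [measurable_cong] = sets_delta_mech[OF x] delta_mechD(5)
  {
    case (cong f g)
    then have "(\<integral>\<^sup>+ z. f z \<partial>Q x) = (\<integral>\<^sup>+ z. g z \<partial>Q x)" "(\<integral>\<^sup>+ z. f z \<partial>Qbar) = (\<integral>\<^sup>+ z. g z \<partial>Qbar)"
      using sets_eq_imp_space_eq[OF sets_delta_mech[OF x]] sets_eq_imp_space_eq[OF delta_mechD(5)]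
      by - (rule nn_integral_cong, simp)+
    then show ?case using cong x by simp
  next
    case (set A)
    then show ?case
      using sets_delta_mech[OF x] delta_mechD(5) by (simp add: emeasure_delta_mech[OF x])
  next
    case (mult u c)
    note mult(2) [measurable]
    show ?case using mult by (simp add: nn_integral_cmult distrib_left mult_ac)
  next
    case (add u v)
    note add(1,4) [measurable]
    show ?case using add by (simp add: nn_integral_add distrib_left add_ac)
  next
    case (seq U)
    note seq(1) [measurable]
    \<comment> \<open>Both sequences increase, which is what allows the supremum of their sum to be
      split.\<close>
    have inc: "incseq (\<lambda>i. ennreal \<alpha> * U i x)"
      "incseq (\<lambda>i. ennreal (1 - \<alpha>) * (\<integral>\<^sup>+ z. U i z \<partial>Qbar))"
      using seq(4) by (auto simp: incseq_def le_fun_def intro!: mult_left_mono nn_integral_mono)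
    have "(\<integral>\<^sup>+ z. (SUP i. U i) z \<partial>Q x) = (SUP i. \<integral>\<^sup>+ z. U i z \<partial>Q x)"
      using seq(4) by (simp add: nn_integral_monotone_convergence_SUP image_comp)
    also have "\<dots> = (SUP i. ennreal \<alpha> * U i x + ennreal (1 - \<alpha>) * (\<integral>\<^sup>+ z. U i z \<partial>Qbar))"
      using seq(3) by simp
    also have "\<dots> = (SUP i. ennreal \<alpha> * U i x) + (SUP i. ennreal (1 - \<alpha>) * (\<integral>\<^sup>+ z. U i z \<partial>Qbar))"
      by (rule ennreal_SUP_add[OF inc])
    also have "\<dots> = ennreal \<alpha> * (SUP i. U i) x + ennreal (1 - \<alpha>) * (\<integral>\<^sup>+ z. (SUP i. U i) z \<partial>Qbar)"
      using seq(4) by (simp add: nn_integral_monotone_convergence_SUP image_comp SUP_mult_left_ennreal)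
    finally show ?case .
  }
qed

text \<open>As 1 - \<open>\<alpha>\<close> is positive, \<open>Q x\<close> dominates a positive
  multiple of \<open>Qbar\<close>, and integrability passes on. The formula then follows from the
  nonnegative case applied to \<open>f\<close> and \<open>- f\<close>.\<close>

lemma
  fixes f :: "'x \<Rightarrow> real"
  assumes x: "x \<in> space XS" and f: "integrable (Q x) f"
  shows integrable_delta_mech: "integrable Qbar f"
    and integral_delta_mech: "(\<integral>z. f z \<partial>Q x) = \<alpha> * f x + (1 - \<alpha>) * (\<integral>z. f z \<partial>Qbar)"
proof -
  have [measurable]: "f \<in> borel_measurable XS"
    using borel_measurable_integrable[OF f] measurable_cong_sets[OF sets_delta_mech[OF x] refl] by blast
  then have fQ: "f \<in> borel_measurable Qbar"
    using measurable_cong_sets[OF delta_mechD(5) refl] by blast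
  have fin: "(\<integral>\<^sup>+ z. ennreal (g z) \<partial>Qbar) \<noteq> \<infinity>"
    if "g \<in> borel_measurable XS" "(\<integral>\<^sup>+ z. ennreal (g z) \<partial>Q x) \<noteq> \<infinity>" for g
    using that delta_mechD(3) by (auto simp: nn_integral_delta_mech[OF x] ennreal_mult_eq_top_iff)
  show Qf: "integrable Qbar f"
    using f fQ fin[of f] fin[of "\<lambda>z. - f z"] by (simp add: real_integrable_def)
  \<comment> \<open>\<open>ennreal\<close> truncates at 0, so these are integrals of positive parts;
    this is where \<open>max 0\<close> comes from.\<close>
  have e: "enn2real (\<integral>\<^sup>+ z. ennreal (g z) \<partial>Q x) =
      \<alpha> * max 0 (g x) + (1 - \<alpha>) * enn2real (\<integral>\<^sup>+ z. ennreal (g z) \<partial>Qbar)"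
    if "g \<in> borel_measurable XS" "(\<integral>\<^sup>+ z. ennreal (g z) \<partial>Q x) \<noteq> \<infinity>" for g
  proof -
    define r where "r = enn2real (\<integral>\<^sup>+ z. ennreal (g z) \<partial>Qbar)"
    have r: "(\<integral>\<^sup>+ z. ennreal (g z) \<partial>Qbar) = ennreal r" "0 \<le> r"
      using fin[OF that] by (auto simp: r_def less_top)
    have "(\<integral>\<^sup>+ z. ennreal (g z) \<partial>Q x) = ennreal \<alpha> * ennreal (max 0 (g x)) + ennreal (1 - \<alpha>) * ennreal r"
      using that(1) by (subst nn_integral_delta_mech[OF x]) (auto simp: r(1))
    also have "\<dots> = ennreal (\<alpha> * max 0 (g x) + (1 - \<alpha>) * r)"
      using delta_mechD(2,3) r(2) by (simp add: ennreal_mult)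
    finally show ?thesis
      using delta_mechD(2,3) r(2) by (simp flip: r_def ennreal_plus)
  qed
  have "(\<integral>z. f z \<partial>Q x) = \<alpha> * (max 0 (f x) - max 0 (- f x)) + (1 - \<alpha>) * (\<integral>z. f z \<partial>Qbar)"
    using f Qf e[of f] e[of "\<lambda>z. - f z"]
    by (simp add: real_lebesgue_integral_def[OF f] real_lebesgue_integral_def[OF Qf]
        real_integrable_def right_diff_distrib)
  then show "(\<integral>z. f z \<partial>Q x) = \<alpha> * f x + (1 - \<alpha>) * (\<integral>z. f z \<partial>Qbar)"
    by (auto simp: max_def)
qed

text \<open>The \<open>Qbar\<close>-integral inside the inverse does not depend on \<open>z\<close>.
  Hence integrability of the inverse gives that of \<open>h\<close>, and averaging
  h/\<open>\<alpha>\<close> over the mixture produces h(v,x) plus exactly the constant that is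
  subtracted.\<close>

lemma integral_delta_inverse:
  fixes h :: "'v \<times> 'x \<Rightarrow> real"
  assumes x: "x \<in> space XS" and int: "integrable (Q x) (\<lambda>z. delta_inverse \<alpha> Qbar h (v, z))"
  shows "(\<integral>z. delta_inverse \<alpha> Qbar h (v, z) \<partial>Q x) = h (v, x)"
proof -
  interpret Qx: prob_space "Q x"
    using measurable_space[OF mech x] by (auto simp: space_prob_algebra)
  define c where "c = (1 - \<alpha>) / \<alpha> * (\<integral>x. h (v, x) \<partial>Qbar)"
  have eq: "(\<lambda>z. h (v, z)) = (\<lambda>z. \<alpha> * (delta_inverse \<alpha> Qbar h (v, z) + c))"
    using delta_mechD(2) by (simp add: delta_inverse_def c_def)
  have hint: "integrable (Q x) (\<lambda>z. h (v, z))"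
    unfolding eq using int by simp
  have "(\<integral>z. delta_inverse \<alpha> Qbar h (v, z) \<partial>Q x) = (\<integral>z. h (v, z) / \<alpha> - c \<partial>Q x)"
    by (simp add: delta_inverse_def c_def)
  also have "\<dots> = (\<integral>z. h (v, z) \<partial>Q x) / \<alpha> - c"
    using hint by (simp add: Qx.prob_space)
  also have "\<dots> = h (v, x)"
    using delta_mechD(2) unfolding integral_delta_mech[OF x hint] c_def
    by (simp add: add_divide_distrib)
  finally show ?thesis .
qed

text \<open>The \<open>Qbar\<close> parts cancel in
  \<open>measure (Q x) B - measure (Q y) B\<close>, which leaves the weight of the point
  mass.\<close>

lemma delta_mech_unique:
  assumes delta': "delta_mech XS ZS Q \<beta> Qbar'" and B: "B \<in> sets XS"
    and x: "x \<in> space XS" "x \<in> B" and y: "y \<in> space XS" "y \<notin> B"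
  shows "\<beta> = \<alpha>"
proof -
  have "measure (Q u) B = \<beta> * indicator B u + (1 - \<beta>) * measure Qbar' B" if "u \<in> space XS" for u
    using delta' that B by (simp add: delta_mech_def measure_return)
  then show ?thesis
    using delta_mechD(6)[OF x(1) B] delta_mechD(6)[OF y(1) B] x y by simp
qed

end

subsection \<open>Inverse mechanisms\<close>

text \<open>A whole family \<open>h y\<close> is treated, since exchanging the integrals over
  \<open>y\<close> and over the sample needs measurability in both arguments jointly.\<close>

lemma borel_measurable_delta_inverse:
  fixes h :: "'y \<Rightarrow> 'v \<times> 'x \<Rightarrow> real"
  assumes delta: "delta_mech XS ZS Q \<alpha> Qbar"
    and h: "(\<lambda>(y, p). h y p) \<in> borel_measurable (N \<Otimes>\<^sub>M (VS \<Otimes>\<^sub>M XS))"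
  shows "(\<lambda>(y, p). delta_inverse \<alpha> Qbar (h y) p) \<in> borel_measurable (N \<Otimes>\<^sub>M (VS \<Otimes>\<^sub>M ZS))"
proof -
  from delta have [measurable_cong]: "sets ZS = sets XS" "sets Qbar = sets XS" and "prob_space Qbar"
    by (auto simp: delta_mech_def)
  interpret prob_space Qbar by fact
  have h1 [measurable]: "(\<lambda>(y, p). h y p) \<in> borel_measurable (N \<Otimes>\<^sub>M (VS \<Otimes>\<^sub>M ZS))"
    using h by measurable
  have "(\<lambda>(q, x). (fst q, fst (snd q), x)) \<in>
      (N \<Otimes>\<^sub>M (VS \<Otimes>\<^sub>M ZS)) \<Otimes>\<^sub>M Qbar \<rightarrow>\<^sub>M N \<Otimes>\<^sub>M (VS \<Otimes>\<^sub>M XS)"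
    by measurable
  from measurable_compose[OF this h]
  have [measurable]: "(\<lambda>(q, x). h (fst q) (fst (snd q), x)) \<in>
      borel_measurable ((N \<Otimes>\<^sub>M (VS \<Otimes>\<^sub>M ZS)) \<Otimes>\<^sub>M Qbar)"
    by (simp add: case_prod_beta)
  have "(\<lambda>q. 1 / \<alpha> * (case q of (y, p) \<Rightarrow> h y p)
        - (1 - \<alpha>) / \<alpha> * (\<integral>x. h (fst q) (fst (snd q), x) \<partial>Qbar))
      \<in> borel_measurable (N \<Otimes>\<^sub>M (VS \<Otimes>\<^sub>M ZS))"
    by measurable
  then show ?thesis
    by (simp add: delta_inverse_def case_prod_beta)
qed

text \<open>\<open>mat_inverse\<close> fails only on matrices that are not units of the matrix ring.
  The remaining point is that the inverse matrix provided by \<open>invertible_mat\<close> has size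
  \<open>n\<close>, which is read off from the two products.\<close>

lemma invertible_mat_imp_mat_inverse:
  fixes A :: "'a::field mat"
  assumes A: "A \<in> carrier_mat n n" and inv: "invertible_mat A"
  obtains B where "mat_inverse A = Some B" "B \<in> carrier_mat n n" "A * B = 1\<^sub>m n" "B * A = 1\<^sub>m n"
proof -
  from inv obtain C where C: "A * C = 1\<^sub>m (dim_row A)" "C * A = 1\<^sub>m (dim_row C)"
    by (auto simp: invertible_mat_def inverts_mat_def)
  from A have A': "dim_row A = n" "dim_col A = n" by auto
  have "dim_col C = n" using arg_cong[OF C(1), of dim_col] A' by simp
  moreover have "dim_row C = n" using arg_cong[OF C(2), of dim_col] A' by simp
  ultimately have "C \<in> carrier_mat n n" by auto
  with A C A' \<open>dim_row C = n\<close> have "A \<in> Units (ring_mat TYPE('a) n undefined)"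
    unfolding Units_def by (auto simp: ring_mat_simps)
  then obtain B where "mat_inverse A = Some B"
    using mat_inverse(1)[OF A, where b = undefined] by (cases "mat_inverse A") auto
  with mat_inverse(2)[OF A this] that show thesis by blast
qed

section \<open>Finite mechanisms and the inverse matrix\<close>

context
  fixes nuV VS :: "'v measure" and XS ZS :: "'x measure" and PVX :: "('v \<times> 'x) measure"
    and Q :: "'x \<Rightarrow> 'x measure" and J :: nat and xe ze :: "nat \<Rightarrow> 'x"
  assumes fin: "Q \<in> Q_fin nuV J xe ze VS XS ZS PVX"
begin

lemma Q_finD:
  shows "Q \<in> XS \<rightarrow>\<^sub>M prob_algebra ZS"
    "bij_betw xe {..<J} (space XS)" "sets XS = Pow (space XS)"
    "bij_betw ze {..<J} (space ZS)" "sets ZS = Pow (space ZS)"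
    "invertible_mat (mech_matrix J xe ze Q)"
  using fin by (auto simp: Q_fin_def)

text \<open>Transposing an inverse gives an inverse of the transpose, so \<open>the\<close> in
  \<open>fin_inverse\<close> is applied to an actual matrix. A right inverse is what is recorded:
  integration against the mechanism applies the transposed matrix after \<open>B\<close>.\<close>

lemma fin_inverse_matrix:
  obtains B where "the (mat_inverse (transpose_mat (mech_matrix J xe ze Q))) = B"
    "B \<in> carrier_mat J J" "transpose_mat (mech_matrix J xe ze Q) * B = 1\<^sub>m J"
proof -
  let ?A = "mech_matrix J xe ze Q"
  have A: "?A \<in> carrier_mat J J" by (simp add: mech_matrix_def)
  obtain C where C: "C \<in> carrier_mat J J" "?A * C = 1\<^sub>m J" "C * ?A = 1\<^sub>m J"
    using invertible_mat_imp_mat_inverse[OF A Q_finD(6)] by metis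
  have "transpose_mat ?A * transpose_mat C = 1\<^sub>m J" "transpose_mat C * transpose_mat ?A = 1\<^sub>m J"
    by (simp_all add: C(2,3) flip: transpose_mult[OF C(1) A] transpose_mult[OF A C(1)])
  then have "invertible_mat (transpose_mat ?A)"
    using A C(1) by (auto simp: invertible_mat_def inverts_mat_def intro!: exI[of _ "transpose_mat C"])
  moreover have "transpose_mat ?A \<in> carrier_mat J J" using A by simp
  ultimately show thesis
    using invertible_mat_imp_mat_inverse that by (metis option.sel)
qed

lemma fin_inverse_ze:
  assumes "j < J"
  shows "fin_inverse J xe ze Q h (v, ze j) =
    vec_index (the (mat_inverse (transpose_mat (mech_matrix J xe ze Q)))
      *\<^sub>v Matrix.vec J (\<lambda>k. h (v, xe k))) j"
  using assms the_inv_into_f_f[OF bij_betw_imp_inj_on[OF Q_finD(4)], of j]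
  by (simp add: fin_inverse_def)

lemma space_ZS_fin:
  assumes "z \<in> space ZS" obtains j where "j < J" "z = ze j"
  using assms Q_finD(4) by (auto simp: bij_betw_def)

text \<open>Integrating over \<open>Q (xe k)\<close> is multiplication by row \<open>k\<close> of
  the transposed mechanism matrix, which undoes \<open>B\<close>. On finitely many atoms every
  function is integrable, so the identity holds unconditionally.\<close>

lemma integral_fin_inverse:
  fixes h :: "'v \<times> 'x \<Rightarrow> real"
  assumes x: "x \<in> space XS"
  shows "(\<integral>z. fin_inverse J xe ze Q h (v, z) \<partial>Q x) = h (v, x)"
proof -
  obtain k where k: "k < J" "x = xe k" using x Q_finD(2) by (auto simp: bij_betw_def)
  obtain B where B: "the (mat_inverse (transpose_mat (mech_matrix J xe ze Q))) = B"
    "B \<in> carrier_mat J J" "transpose_mat (mech_matrix J xe ze Q) * B = 1\<^sub>m J"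
    by (rule fin_inverse_matrix)
  interpret Qx: prob_space "Q x"
    using measurable_space[OF Q_finD(1) x] by (auto simp: space_prob_algebra)
  have sQ: "sets (Q x) = sets ZS"
    using measurable_space[OF Q_finD(1) x] by (auto simp: space_prob_algebra)
  have spQ: "space (Q x) = space ZS" by (rule sets_eq_imp_space_eq[OF sQ])
  have zs: "{ze j} \<in> sets (Q x)" if "j < J" for j
    using that Q_finD(4,5) by (auto simp: sQ bij_betw_def)
  let ?f = "fin_inverse J xe ze Q h"
  let ?h = "Matrix.vec J (\<lambda>k. h (v, xe k))"
  have inj: "ze j = ze i \<longleftrightarrow> j = i" if "j < J" "i < J" for i j
    using that Q_finD(4) by (auto simp: bij_betw_def inj_on_def)
  have "(\<integral>z. ?f (v, z) \<partial>Q x) = (\<integral>z. (\<Sum>j<J. ?f (v, ze j) * indicator {ze j} z) \<partial>Q x)"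
  proof (rule Bochner_Integration.integral_cong[OF refl])
    fix z assume "z \<in> space (Q x)"
    then obtain i where i: "i < J" "z = ze i" using space_ZS_fin spQ by metis
    have "(\<Sum>j<J. ?f (v, ze j) * indicator {ze j} z) = (\<Sum>j<J. if j = i then ?f (v, ze i) else 0)"
      using i by (intro sum.cong) (auto simp: inj indicator_def)
    then show "?f (v, z) = (\<Sum>j<J. ?f (v, ze j) * indicator {ze j} z)" using i by simp
  qed
  also have "\<dots> = (\<Sum>j<J. ?f (v, ze j) * measure (Q x) {ze j})"
    using zs by (subst Bochner_Integration.integral_sum) (auto simp: less_top[symmetric])
  also have "\<dots> = (\<Sum>j<J. measure (Q x) {ze j} * vec_index (B *\<^sub>v ?h) j)"
    by (intro sum.cong) (auto simp: fin_inverse_ze B(1))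
  also have "\<dots> = vec_index (transpose_mat (mech_matrix J xe ze Q) *\<^sub>v (B *\<^sub>v ?h)) k"
    using k B(2) by (simp add: mech_matrix_def scalar_prod_def lessThan_atLeast0)
  also have "transpose_mat (mech_matrix J xe ze Q) *\<^sub>v (B *\<^sub>v ?h) = ?h"
  proof -
    have "transpose_mat (mech_matrix J xe ze Q) \<in> carrier_mat J J" by (simp add: mech_matrix_def)
    then have "transpose_mat (mech_matrix J xe ze Q) *\<^sub>v (B *\<^sub>v ?h) =
        (transpose_mat (mech_matrix J xe ze Q) * B) *\<^sub>v ?h"
      using B(2) by (intro assoc_mult_mat_vec[symmetric]) auto
    then show ?thesis unfolding B(3) by simp
  qed
  finally show ?thesis using k by simp
qed

text \<open>The index lookup in \<open>fin_inverse\<close> is replaced by a finite sum over the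
  atoms \<open>{ze j}\<close>, each an indicator times a linear combination of the sections of
  \<open>h\<close> at the points \<open>xe k\<close>.\<close>

lemma borel_measurable_fin_inverse:
  fixes h :: "'y \<Rightarrow> 'v \<times> 'x \<Rightarrow> real"
  assumes h: "(\<lambda>(y, p). h y p) \<in> borel_measurable (N \<Otimes>\<^sub>M (VS \<Otimes>\<^sub>M XS))"
  shows "(\<lambda>(y, p). fin_inverse J xe ze Q (h y) p) \<in> borel_measurable (N \<Otimes>\<^sub>M (VS \<Otimes>\<^sub>M ZS))"
proof -
  obtain B where B: "the (mat_inverse (transpose_mat (mech_matrix J xe ze Q))) = B"
    "B \<in> carrier_mat J J" "transpose_mat (mech_matrix J xe ze Q) * B = 1\<^sub>m J"
    by (rule fin_inverse_matrix)
  have inj: "ze j = ze i \<longleftrightarrow> j = i" if "j < J" "i < J" for i j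
    using that Q_finD(4) by (auto simp: bij_betw_def inj_on_def)
  have zs [measurable]: "{ze j} \<in> sets ZS" if "j < J" for j
    using that Q_finD(4,5) by (auto simp: bij_betw_def)
  have hk [measurable]: "(\<lambda>q. h (fst q) (fst (snd q), xe k)) \<in> borel_measurable (N \<Otimes>\<^sub>M (VS \<Otimes>\<^sub>M ZS))"
    if "k < J" for k
  proof -
    have "xe k \<in> space XS" using that Q_finD(2) by (auto simp: bij_betw_def)
    then have "(\<lambda>q. (fst q, fst (snd q), xe k)) \<in> N \<Otimes>\<^sub>M (VS \<Otimes>\<^sub>M ZS) \<rightarrow>\<^sub>M N \<Otimes>\<^sub>M (VS \<Otimes>\<^sub>M XS)"
      by measurable
    from measurable_compose[OF this h] show ?thesis by simp
  qed
  have "(\<lambda>q. \<Sum>j<J. indicator {ze j} (snd (snd q)) *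
      (\<Sum>k<J. index_mat B (j, k) * h (fst q) (fst (snd q), xe k)))
    \<in> borel_measurable (N \<Otimes>\<^sub>M (VS \<Otimes>\<^sub>M ZS))" (is "?g \<in> _")
    by (intro borel_measurable_sum borel_measurable_times borel_measurable_const hk
        measurable_compose[OF measurable_compose[OF measurable_snd measurable_snd]
          borel_measurable_indicator] zs) auto
  moreover have "fin_inverse J xe ze Q (h (fst q)) (snd q) = ?g q"
    if q: "q \<in> space (N \<Otimes>\<^sub>M (VS \<Otimes>\<^sub>M ZS))" for q
  proof -
    from q have "snd (snd q) \<in> space ZS"
      by (auto simp: space_pair_measure)
    then obtain i where i: "i < J" "snd (snd q) = ze i"
      by (rule space_ZS_fin)
    have "?g q = (\<Sum>j<J. if j = i then
        (\<Sum>k<J. index_mat B (i, k) * h (fst q) (fst (snd q), xe k)) else 0)"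
      using i by (intro sum.cong) (auto simp: inj indicator_def)
    also have "\<dots> = (\<Sum>k<J. index_mat B (i, k) * h (fst q) (fst (snd q), xe k))"
      using i by simp
    also have "\<dots> = fin_inverse J xe ze Q (h (fst q)) (fst (snd q), ze i)"
      using i B(2) by (simp add: fin_inverse_ze B(1) scalar_prod_def lessThan_atLeast0)
    finally show ?thesis using i by (metis prod.collapse)
  qed
  ultimately show ?thesis
    by (simp add: case_prod_beta cong: measurable_cong)
qed

end

section \<open>The inverse of a mechanism of either class\<close>

lemma mech_inverse_Q_delta:
  assumes Q: "Q \<in> Q_delta XS ZS"
  obtains \<alpha> Qbar where "delta_mech XS ZS Q \<alpha> Qbar" "mech_inverse J xe ze XS ZS Q = delta_inverse \<alpha> Qbar"
proof -
  let ?p = "SOME (\<alpha>, Qbar). delta_mech XS ZS Q \<alpha> Qbar"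
  from Q have "\<exists>p. case p of (\<alpha>, Qbar) \<Rightarrow> delta_mech XS ZS Q \<alpha> Qbar"
    by (auto simp: Q_delta_def)
  then have "case ?p of (\<alpha>, Qbar) \<Rightarrow> delta_mech XS ZS Q \<alpha> Qbar"
    by (rule someI_ex)
  then show thesis
    using Q by (intro that[of "fst ?p" "snd ?p"]) (simp_all add: mech_inverse_def case_prod_beta)
qed

text \<open>The cases follow the priority built into \<open>mech_inverse\<close>: a mechanism of
  both classes counts as a delta mechanism, so each case carries its own formula.\<close>

lemma Q_psi_cases [consumes 1, case_names delta fin]:
  fixes nuV VS :: "'v measure" and XS ZS :: "'x measure"
  assumes "Q \<in> Q_psi nuV J xe ze VS XS ZS PVX"
  obtains \<alpha> Qbar where "delta_mech XS ZS Q \<alpha> Qbar"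
      "mech_inverse J xe ze XS ZS Q = (delta_inverse \<alpha> Qbar :: ('v \<times> 'x \<Rightarrow> real) \<Rightarrow> 'v \<times> 'x \<Rightarrow> real)"
    | "Q \<in> Q_fin nuV J xe ze VS XS ZS PVX"
      "mech_inverse J xe ze XS ZS Q = (fin_inverse J xe ze Q :: ('v \<times> 'x \<Rightarrow> real) \<Rightarrow> 'v \<times> 'x \<Rightarrow> real)"
proof (cases "Q \<in> Q_delta XS ZS")
  case True
  then show thesis by (rule mech_inverse_Q_delta) (rule that(1))
next
  case False
  with assms show thesis by (intro that(2)) (auto simp: Q_psi_def mech_inverse_def)
qed

lemma Q_psi_mechanism: "Q \<in> Q_psi nuV J xe ze VS XS ZS PVX \<Longrightarrow> Q \<in> XS \<rightarrow>\<^sub>M prob_algebra ZS"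
  by (auto simp: Q_psi_def Q_fin_def Q_delta_def)

lemma borel_measurable_mech_inverse:
  fixes VS :: "'v measure" and h :: "'y \<Rightarrow> 'v \<times> 'x \<Rightarrow> real"
  assumes Q: "Q \<in> Q_psi nuV J xe ze VS XS ZS PVX"
    and h: "(\<lambda>(y, p). h y p) \<in> borel_measurable (N \<Otimes>\<^sub>M (VS \<Otimes>\<^sub>M XS))"
  shows "(\<lambda>(y, p). mech_inverse J xe ze XS ZS Q (h y) p) \<in> borel_measurable (N \<Otimes>\<^sub>M (VS \<Otimes>\<^sub>M ZS))"
  using Q
proof (cases rule: Q_psi_cases)
  case (delta \<alpha> Qbar)
  then show ?thesis using borel_measurable_delta_inverse[OF _ h] by simp
next
  case fin
  then show ?thesis using borel_measurable_fin_inverse[OF _ h] by simp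
qed

lemma integral_mech_inverse:
  fixes VS :: "'v measure" and h :: "'v \<times> 'x \<Rightarrow> real"
  assumes Q: "Q \<in> Q_psi nuV J xe ze VS XS ZS PVX" and x: "x \<in> space XS"
    and int: "integrable (Q x) (\<lambda>z. mech_inverse J xe ze XS ZS Q h (v, z))"
  shows "(\<integral>z. mech_inverse J xe ze XS ZS Q h (v, z) \<partial>Q x) = h (v, x)"
  using Q
proof (cases rule: Q_psi_cases)
  case (delta \<alpha> Qbar)
  with int show ?thesis
    using integral_delta_inverse[OF Q_psi_mechanism[OF Q] delta(1) x] by simp
next
  case fin
  then show ?thesis using integral_fin_inverse[OF _ x] by simp
qed

section \<open>Variance bound for delta mechanisms\<close>

context privatized_law
begin

text \<open>Squaring the difference costs a factor 2, which gives 2/\<open>\<alpha>\<close>^2 for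
  the \<open>h\<close> term and the same for the \<open>Qbar\<close>-mean term. Each of the two is
  then at most the second moment of \<open>h\<close>, hence 4/\<open>\<alpha>\<close>^2.\<close>

lemma nn_integral_delta_inverse_sq_le:
  fixes h :: "'v \<times> 'x \<Rightarrow> real"
  assumes delta: "delta_mech XS ZS Q \<alpha> Qbar"
    and h: "h \<in> borel_measurable (VS \<Otimes>\<^sub>M XS)"
  shows "(\<integral>\<^sup>+ p. ennreal ((delta_inverse \<alpha> Qbar h p)\<^sup>2) \<partial>PVZ) \<le>
    ennreal (4 / \<alpha>\<^sup>2) * (\<integral>\<^sup>+ p. ennreal ((h p)\<^sup>2) \<partial>PVZ)"
proof -
  note D = delta_mechD[OF mechanism delta]
  note [measurable_cong] = D(1,5)
  interpret Qbar: prob_space Qbar by (rule D)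
  have h' [measurable]: "h \<in> borel_measurable (VS \<Otimes>\<^sub>M ZS)" using h by measurable
  define g where "g v = (\<integral>x. h (v, x) \<partial>Qbar)" for v
  have [measurable]: "(\<lambda>(v, x). h (v, x)) \<in> borel_measurable (VS \<Otimes>\<^sub>M Qbar)"
    using h by simp
  have [measurable]: "g \<in> borel_measurable VS"
    unfolding g_def by measurable
  let ?a = "ennreal (2 / \<alpha>\<^sup>2)" and ?b = "ennreal (1 - \<alpha>)"
  have le: "ennreal ((delta_inverse \<alpha> Qbar h p)\<^sup>2) \<le>
      ?a * ennreal ((h p)\<^sup>2) + ?a * (?b * ennreal ((g (fst p))\<^sup>2))" for p
  proof -
    obtain v z where p: "p = (v, z)" by force
    have "(h p - (1 - \<alpha>) * g v)\<^sup>2 \<le> 2 * (h p)\<^sup>2 + 2 * ((1 - \<alpha>)\<^sup>2 * (g v)\<^sup>2)"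
      using zero_le_power2[of "h p + (1 - \<alpha>) * g v"] by (simp add: power2_eq_square algebra_simps)
    \<comment> \<open>One factor 1 - \<open>\<alpha>\<close> is given up and the other kept, because
      it is the weight of \<open>Qbar\<close> in \<open>Q x\<close> and is used up in
      \<open>G\<close>.\<close>
    also have "(1 - \<alpha>)\<^sup>2 * (g v)\<^sup>2 \<le> (1 - \<alpha>) * (g v)\<^sup>2"
      using D(2,3) by (intro mult_right_mono) (auto simp: power2_eq_square mult_left_le)
    finally have "(h p - (1 - \<alpha>) * g v)\<^sup>2 / \<alpha>\<^sup>2 \<le> (2 * (h p)\<^sup>2 + 2 * ((1 - \<alpha>) * (g v)\<^sup>2)) / \<alpha>\<^sup>2"
      by (intro divide_right_mono) auto
    also have "(h p - (1 - \<alpha>) * g v)\<^sup>2 / \<alpha>\<^sup>2 = (delta_inverse \<alpha> Qbar h p)\<^sup>2"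
      by (simp add: delta_inverse_def p g_def power_divide[symmetric] diff_divide_distrib[of "h (v, z)"])
    finally have "(delta_inverse \<alpha> Qbar h p)\<^sup>2 \<le>
        2 / \<alpha>\<^sup>2 * (h p)\<^sup>2 + 2 / \<alpha>\<^sup>2 * ((1 - \<alpha>) * (g v)\<^sup>2)"
      by (simp add: add_divide_distrib)
    then show ?thesis
      using D(3) by (simp add: p flip: ennreal_mult ennreal_plus)
  qed
  have G: "?b * (\<integral>\<^sup>+ p. ennreal ((g (fst p))\<^sup>2) \<partial>PVZ) \<le> (\<integral>\<^sup>+ p. ennreal ((h p)\<^sup>2) \<partial>PVZ)"
  proof -
    have "?b * (\<integral>\<^sup>+ p. ennreal ((g (fst p))\<^sup>2) \<partial>PVZ) = (\<integral>\<^sup>+ p. ?b * ennreal ((g (fst p))\<^sup>2) \<partial>PVZ)"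
      by (rule nn_integral_cmult[symmetric]) measurable
    also have "\<dots> = (\<integral>\<^sup>+ (v, x). (\<integral>\<^sup>+ z. ?b * ennreal ((g v)\<^sup>2) \<partial>Q x) \<partial>PVX)"
      by (subst nn_integral_PVZ) simp_all
    also have "\<dots> \<le> (\<integral>\<^sup>+ (v, x). (\<integral>\<^sup>+ z. ennreal ((h (v, z))\<^sup>2) \<partial>Q x) \<partial>PVX)"
    proof (rule nn_integral_mono, clarsimp simp: space_PVX)
      fix v x assume v: "v \<in> space VS" and x: "x \<in> space XS"
      interpret Qx: prob_space "Q x" using x by (rule prob_space_mechanism)
      have hv [measurable]: "(\<lambda>z. h (v, z)) \<in> borel_measurable XS"
        using v h by measurable
      have "?b * ennreal ((g v)\<^sup>2) * emeasure (Q x) (space (Q x)) = ?b * ennreal ((g v)\<^sup>2)"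
        by (simp add: Qx.emeasure_space_1)
      also have "\<dots> \<le> ?b * (\<integral>\<^sup>+ z. ennreal ((h (v, z))\<^sup>2) \<partial>Qbar)"
        unfolding g_def by (intro mult_left_mono Qbar.expectation_sq_le_nn_integral) auto
      \<comment> \<open>The mixture formula, with the nonnegative point-mass term dropped.\<close>
      also have "\<dots> \<le> (\<integral>\<^sup>+ z. ennreal ((h (v, z))\<^sup>2) \<partial>Q x)"
        by (subst nn_integral_delta_mech[OF mechanism delta x]) auto
      finally show "?b * ennreal ((g v)\<^sup>2) * emeasure (Q x) (space (Q x)) \<le>
          (\<integral>\<^sup>+ z. ennreal ((h (v, z))\<^sup>2) \<partial>Q x)" .
    qed
    also have "\<dots> = (\<integral>\<^sup>+ p. ennreal ((h p)\<^sup>2) \<partial>PVZ)"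
      by (rule nn_integral_PVZ[symmetric]) measurable
    finally show ?thesis .
  qed
  have "(\<integral>\<^sup>+ p. ennreal ((delta_inverse \<alpha> Qbar h p)\<^sup>2) \<partial>PVZ) \<le>
      (\<integral>\<^sup>+ p. ?a * ennreal ((h p)\<^sup>2) + ?a * (?b * ennreal ((g (fst p))\<^sup>2)) \<partial>PVZ)"
    by (intro nn_integral_mono le)
  also have "\<dots> = ?a * (\<integral>\<^sup>+ p. ennreal ((h p)\<^sup>2) \<partial>PVZ)
      + ?a * (?b * (\<integral>\<^sup>+ p. ennreal ((g (fst p))\<^sup>2) \<partial>PVZ))"
    by (simp add: nn_integral_add nn_integral_cmult)
  also have "\<dots> \<le> ?a * (\<integral>\<^sup>+ p. ennreal ((h p)\<^sup>2) \<partial>PVZ) + ?a * (\<integral>\<^sup>+ p. ennreal ((h p)\<^sup>2) \<partial>PVZ)"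
    by (intro add_left_mono mult_left_mono G) simp
  also have "\<dots> = (?a + ?a) * (\<integral>\<^sup>+ p. ennreal ((h p)\<^sup>2) \<partial>PVZ)"
    by (simp add: distrib_right)
  also have "?a + ?a = ennreal (4 / \<alpha>\<^sup>2)"
    by (simp flip: ennreal_plus)
  finally show ?thesis .
qed

text \<open>The chosen pair (\<open>\<beta>\<close>, \<open>Qbar'\<close>) behind the inverse and
  the given pair need not coincide. Equal weights suffice, since the second moment bound applies to
  the chosen pair and involves the weight alone.\<close>

lemma ext_variance_mech_inverse_le:
  fixes h :: "'v \<times> 'x \<Rightarrow> real"
  assumes Q: "Q \<in> Q_psi nuV J xe ze VS XS ZS PVX" and delta: "delta_mech XS ZS Q \<alpha> Qbar"
    and h: "h \<in> borel_measurable (VS \<Otimes>\<^sub>M XS)"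
  shows "ext_variance PVZ (mech_inverse J xe ze XS ZS Q h) \<le>
    ennreal (4 / \<alpha>\<^sup>2) * (\<integral>\<^sup>+ p. ennreal ((h p)\<^sup>2) \<partial>PVZ)"
proof -
  have Q': "Q \<in> Q_delta XS ZS" using delta mechanism by (auto simp: Q_delta_def)
  obtain \<beta> Qbar' where delta': "delta_mech XS ZS Q \<beta> Qbar'"
    and inv: "mech_inverse J xe ze XS ZS Q =
      (delta_inverse \<beta> Qbar' :: ('v \<times> 'x \<Rightarrow> real) \<Rightarrow> 'v \<times> 'x \<Rightarrow> real)"
    using Q' by (rule mech_inverse_Q_delta)
  note D = delta_mechD[OF mechanism delta]
  interpret PVZ: prob_space PVZ by (rule prob_space_PVZ)
  \<comment> \<open>A one-point parameter space specialises joint measurability of families to the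
    single function \<open>h\<close>.\<close>
  have "(\<lambda>((y::unit), p). h p) \<in> borel_measurable (count_space UNIV \<Otimes>\<^sub>M (VS \<Otimes>\<^sub>M XS))"
    using h by measurable
  from measurable_compose[OF measurable_Pair1' borel_measurable_mech_inverse[OF Q this], of "()"]
  have m: "mech_inverse J xe ze XS ZS Q h \<in> borel_measurable PVZ"
    by (simp add: measurable_cong_sets[OF sets_PVZ refl])
  have "(\<integral>\<^sup>+ p. ennreal ((delta_inverse \<beta> Qbar' h p)\<^sup>2) \<partial>PVZ) \<le>
      ennreal (4 / \<alpha>\<^sup>2) * (\<integral>\<^sup>+ p. ennreal ((h p)\<^sup>2) \<partial>PVZ)"
  proof (cases "\<beta> = \<alpha>")
    case True
    then show ?thesis using nn_integral_delta_inverse_sq_le[OF delta' h] by simp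
  next
    case False
    \<comment> \<open>The choice of parameters is not unique only if \<open>XS\<close> is trivial; then \<open>h (v, _)\<close> is constant.\<close>
    interpret Qbar': prob_space Qbar' using delta_mechD(4)[OF mechanism delta'] .
    have "delta_inverse \<beta> Qbar' h (v, z) = h (v, z)" if v: "v \<in> space VS" and z: "z \<in> space ZS" for v z
    proof -
      from z have z': "z \<in> space XS" using sets_eq_imp_space_eq[OF D(1)] by simp
      have hv: "(\<lambda>x. h (v, x)) \<in> borel_measurable XS"
        using v h by measurable
      \<comment> \<open>If \<open>h (v, _)\<close> took another value somewhere, this level set
        would separate two points and force \<open>\<beta>\<close> =
        \<open>\<alpha>\<close>.\<close>
      have B: "(\<lambda>x. h (v, x)) -` {h (v, z)} \<inter> space XS \<in> sets XS"
        using hv by (rule measurable_sets) simp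
      have "h (v, x) = h (v, z)" if "x \<in> space XS" for x
        using delta_mech_unique[OF mechanism delta delta' B z' _ that] False z' that by auto
      then have "(\<integral>x. h (v, x) \<partial>Qbar') = (\<integral>x. h (v, z) \<partial>Qbar')"
        using sets_eq_imp_space_eq[OF delta_mechD(5)[OF mechanism delta']]
        by (intro Bochner_Integration.integral_cong) auto
      then show ?thesis
        using delta_mechD(2)[OF mechanism delta']
        by (simp add: delta_inverse_def Qbar'.prob_space field_simps)
    qed
    then have "(\<integral>\<^sup>+ p. ennreal ((delta_inverse \<beta> Qbar' h p)\<^sup>2) \<partial>PVZ) =
        (\<integral>\<^sup>+ p. ennreal ((h p)\<^sup>2) \<partial>PVZ)"
      by (intro nn_integral_cong) (auto simp: space_PVZ)
    also have "\<dots> = ennreal 1 * (\<integral>\<^sup>+ p. ennreal ((h p)\<^sup>2) \<partial>PVZ)"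
      by simp
    also have "\<dots> \<le> ennreal (4 / \<alpha>\<^sup>2) * (\<integral>\<^sup>+ p. ennreal ((h p)\<^sup>2) \<partial>PVZ)"
    proof (intro mult_right_mono ennreal_leI)
      have "\<alpha>\<^sup>2 \<le> 1" using D(2,3) by (simp add: power_le_one)
      then show "1 \<le> 4 / \<alpha>\<^sup>2" using D(2) by (simp add: le_divide_eq)
    qed simp
    finally show ?thesis .
  qed
  then show ?thesis
    using PVZ.ext_variance_le[OF m] unfolding inv by (rule order_trans[rotated])
qed

end

subsection \<open>The estimator\<close>

text \<open>The inequality between stochastic orders is encoded by witnesses \<open>A\<close> and
  \<open>B\<close> of these orders for which it holds at every sample point, not merely with high
  probability. They are twice the integral of T_n^2 and four times that of D_n^2.\<close>

theorem proposition3: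
  fixes L K :: "'l set" and M :: "'l \<Rightarrow> 'a measure"
    and XS ZS :: "'x measure"
    and PVX :: "(('l \<Rightarrow> 'a) \<times> 'x) measure"
    and Q :: "'x \<Rightarrow> 'x measure"
    and nuV :: "('l \<Rightarrow> 'a) measure" and J :: nat and xe ze :: "nat \<Rightarrow> 'x"
    and TT :: "'t set" and \<tau> :: 't
    and w :: "nat \<Rightarrow> nat \<Rightarrow> ('l \<Rightarrow> 'a) \<Rightarrow> 'x \<Rightarrow> ('l \<Rightarrow> 'a) \<Rightarrow> 'x \<Rightarrow> 't \<Rightarrow> real"
    and est :: "nat \<Rightarrow> (nat \<Rightarrow> ('l \<Rightarrow> 'a) \<times> 'x) \<Rightarrow> 't"
    and a :: "nat \<Rightarrow> real"
  assumes "K \<subseteq> L"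
    and "prob_space PVX" and "sets PVX = sets (PiM L M \<Otimes>\<^sub>M XS)"
    and "Q \<in> Q_psi nuV J xe ze (PiM L M) XS ZS PVX"
    and "\<And>n i t. i \<in> {1..n} \<Longrightarrow> t \<in> TT \<Longrightarrow>
           (\<lambda>((v1, x), (v', x')). w n i v1 x v' x' t)
             \<in> borel_measurable ((PiM K M \<Otimes>\<^sub>M XS) \<Otimes>\<^sub>M (PiM L M \<Otimes>\<^sub>M XS))"
    and "\<And>n i v1 x t. i \<in> {1..n} \<Longrightarrow> v1 \<in> space (PiM K M) \<Longrightarrow> x \<in> space XS \<Longrightarrow> t \<in> TT \<Longrightarrow>
           (\<lambda>(v', x'). w n i v1 x v' x' t)
             \<in> mech_inverse_dom nuV J xe ze (PiM L M) XS ZS PVX Q"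
    and "\<tau> \<in> TT"
    and "\<And>n s. s \<in> space (PiM {1..n} (\<lambda>_. law_VZ (PiM L M) ZS PVX Q)) \<Longrightarrow> est n s \<in> TT"
    and "stoch_O (\<lambda>n. PiM {1..n} (\<lambda>_. law_VZ (PiM L M) ZS PVX Q))
           (\<lambda>n s. \<integral>\<^sup>+ (v, x). ennreal
              ((T_stat (mech_inverse J xe ze XS ZS Q) w est \<tau> n s (restrict v K, x))\<^sup>2) \<partial>PVX)
           (\<lambda>n. ennreal ((a n)\<^sup>2))"
  shows "(\<forall>\<theta> \<in> L2 (law_V1X K M XS PVX).
           \<exists>A B.
             stoch_O (\<lambda>n. PiM {1..n} (\<lambda>_. law_VZ (PiM L M) ZS PVX Q)) A
               (\<lambda>n. ennreal ((a n)\<^sup>2)) \<and>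
             stoch_O (\<lambda>n. PiM {1..n} (\<lambda>_. law_VZ (PiM L M) ZS PVX Q)) B
               (\<lambda>n. ennreal (1 / (real n)\<^sup>2) *
                  (\<Sum>i\<in>{1..n}. \<integral>\<^sup>+ y. sigma_bar_sq (mech_inverse J xe ze XS ZS Q) w
                       (law_VZ (PiM L M) ZS PVX Q) \<tau> n i y \<partial>law_V1X K M XS PVX)) \<and>
             (\<forall>n\<ge>1. \<forall>s \<in> space (PiM {1..n} (\<lambda>_. law_VZ (PiM L M) ZS PVX Q)).
                (\<integral>\<^sup>+ (v, x). ennreal
                   ((theta_check (mech_inverse J xe ze XS ZS Q) w est n s (restrict v K, x)
                     - \<theta> (restrict v K, x))\<^sup>2) \<partial>PVX)
                \<le> A n s + B n s
                  + 4 * (\<integral>\<^sup>+ (v1, x). ennreal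
                      ((1 / real n * (\<Sum>i\<in>{1..n}. \<integral>(v', x'). w n i v1 x v' x' \<tau> \<partial>PVX)
                        - \<theta> (v1, x))\<^sup>2) \<partial>law_V1X K M XS PVX)))
       \<and> (\<forall>\<alpha> Qbar. delta_mech XS ZS Q \<alpha> Qbar \<longrightarrow>
            (\<forall>n. \<forall>i\<in>{1..n}. \<forall>v1\<in>space (PiM K M). \<forall>x\<in>space XS.
               sigma_bar_sq (mech_inverse J xe ze XS ZS Q) w
                   (law_VZ (PiM L M) ZS PVX Q) \<tau> n i (v1, x)
               \<le> ennreal (4 / \<alpha>\<^sup>2) *
                  (\<integral>\<^sup>+ (v, z). ennreal ((w n i v1 x v z \<tau>)\<^sup>2) \<partial>law_VZ (PiM L M) ZS PVX Q)))"
proof -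
  let ?V = "PiM L M" and ?Y = "law_V1X K M XS PVX"
  let ?inv = "mech_inverse J xe ze XS ZS Q
    :: (('l \<Rightarrow> 'a) \<times> 'x \<Rightarrow> real) \<Rightarrow> ('l \<Rightarrow> 'a) \<times> 'x \<Rightarrow> real"
  let ?P = "law_VZ ?V ZS PVX Q"
  let ?S = "\<lambda>n. PiM {1..n} (\<lambda>_. ?P)"
  note psi = assms(4) and TT = \<open>\<tau> \<in> TT\<close> and est = assms(8)
  interpret privatized_law ?V XS ZS PVX Q
    by (rule privatized_law.intro[OF assms(2,3) Q_psi_mechanism[OF psi]])
  interpret PVX: prob_space PVX by (rule prob_PVX)
  have proj [measurable]: "(\<lambda>(v, x). (restrict v K, x)) \<in> PVX \<rightarrow>\<^sub>M PiM K M \<Otimes>\<^sub>M XS"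
    using measurable_restrict_subset[OF \<open>K \<subseteq> L\<close>, of M] by measurable
  have sets_Y [measurable_cong]: "sets ?Y = sets (PiM K M \<Otimes>\<^sub>M XS)"
    by (simp add: law_V1X_def)
  have space_Y: "space ?Y = space (PiM K M) \<times> space XS"
    using sets_eq_imp_space_eq[OF sets_Y] by (simp add: space_pair_measure)
  interpret Y: prob_space ?Y
    unfolding law_V1X_def by (rule PVX.prob_space_distr[OF proj])
  have to_Y: "(\<integral>\<^sup>+ (v, x). f (restrict v K, x) \<partial>PVX) = (\<integral>\<^sup>+ y. f y \<partial>?Y)"
    if "f \<in> borel_measurable ?Y" for f :: "('l \<Rightarrow> 'a) \<times> 'x \<Rightarrow> ennreal"
    using that unfolding law_V1X_def
    by (subst nn_integral_distr[OF proj]) (simp_all add: case_prod_unfold)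
  \<comment> \<open>The curried arguments are regrouped into a parameter \<open>y\<close> = (v1,x)
    and an observation \<open>p\<close>, the form in which the results on families of functions
    apply.\<close>
  define h where "h n i t y p = w n i (fst y) (snd y) (fst p) (snd p) t" for n i t y p
  define wb where "wb n i t y = ?inv (h n i t y)" for n i t y
  define m where "m n i y = (\<integral>p. h n i \<tau> y p \<partial>PVX)" for n i y
  have w_bar_eq: "w_bar ?inv w n i (fst y) (snd y) (fst p) (snd p) t = wb n i t y p" for n i y p t
    by (simp add: w_bar_def wb_def h_def[abs_def] case_prod_unfold)
  have h_meas: "(\<lambda>(y, p). h n i t y p) \<in> borel_measurable (?Y \<Otimes>\<^sub>M (?V \<Otimes>\<^sub>M XS))"
    if "i \<in> {1..n}" "t \<in> TT" for n i t
    using assms(5)[OF that] unfolding h_def case_prod_unfold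
    by (simp add: measurable_cong_sets[OF sets_pair_measure_cong[OF sets_Y refl] refl])
  have h_meas': "h n i t y \<in> borel_measurable (?V \<Otimes>\<^sub>M XS)"
    if "i \<in> {1..n}" "t \<in> TT" "y \<in> space ?Y" for n i t y
    using measurable_compose[OF measurable_Pair1'[OF that(3)] h_meas[OF that(1,2)]] by simp
  have wb_meas: "(\<lambda>(y, p). wb n i t y p) \<in> borel_measurable (?Y \<Otimes>\<^sub>M ?P)"
    if "i \<in> {1..n}" "t \<in> TT" for n i t
    using borel_measurable_mech_inverse[OF psi h_meas[OF that]] unfolding wb_def
    by (simp add: measurable_cong_sets[OF sets_pair_measure_cong[OF refl sets_PVZ] refl])
  have wb_meas': "(\<lambda>y. wb n i t y p) \<in> borel_measurable ?Y"
    if "i \<in> {1..n}" "t \<in> TT" "p \<in> space ?P" for n i t p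
    using measurable_compose[OF measurable_Pair2'[OF that(3)] wb_meas[OF that(1,2)]] by simp
  have m_meas: "m n i \<in> borel_measurable ?Y" if "i \<in> {1..n}" for n i
  proof -
    have "(\<lambda>(y, p). h n i \<tau> y p) \<in> borel_measurable (?Y \<Otimes>\<^sub>M PVX)"
      using h_meas[OF that TT] by measurable
    then show ?thesis
      unfolding m_def by (rule PVX.borel_measurable_lebesgue_integral)
  qed
  have mean: "(\<integral>p. wb n i \<tau> y p \<partial>?P) = m n i y"
    if i: "i \<in> {1..n}" and y: "y \<in> space ?Y" and int: "integrable ?P (wb n i \<tau> y)" for n i y
    unfolding m_def
  proof (rule integral_PVZ[OF int])
    show "h n i \<tau> y \<in> borel_measurable PVX"
      using h_meas'[OF i TT y] by measurable
    show "(\<integral>z. wb n i \<tau> y (v, z) \<partial>Q x) = h n i \<tau> y (v, x)"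
      if "x \<in> space XS" "integrable (Q x) (\<lambda>z. wb n i \<tau> y (v, z))" for v x
      using integral_mech_inverse[OF psi that(1)] that(2) unfolding wb_def .
  qed
  have sigma_eq: "sigma_bar_sq ?inv w ?P \<tau> n i y = ext_variance ?P (wb n i \<tau> y)" for n i y
    using w_bar_eq[of n i y _ \<tau>] by (simp add: sigma_bar_sq_def case_prod_unfold)
  define D where "D n s y = 1 / real n * (\<Sum>i\<in>{1..n}. wb n i \<tau> y (s i) - m n i y)" for n s y
  have stoch_D: "stoch_O ?S (\<lambda>n s. \<integral>\<^sup>+ y. ennreal ((D n s y)\<^sup>2) \<partial>?Y)
      (\<lambda>n. ennreal (1 / (real n)\<^sup>2) * (\<Sum>i\<in>{1..n}. \<integral>\<^sup>+ y. sigma_bar_sq ?inv w ?P \<tau> n i y \<partial>?Y))"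
    unfolding D_def sigma_eq
    by (rule stoch_O_integrated_mean_deviation_sq[OF prob_space_PVZ Y.sigma_finite_measure_axioms])
       (auto intro!: wb_meas m_meas TT mean)
  \<comment> \<open>The first two constants are written with \<open>ennreal\<close> to match the
    shape produced by \<open>stoch_O_cmult\<close>.\<close>
  have bound: "(\<integral>\<^sup>+ (v, x). ennreal ((theta_check ?inv w est n s (restrict v K, x)
         - \<theta> (restrict v K, x))\<^sup>2) \<partial>PVX)
      \<le> ennreal 2 * (\<integral>\<^sup>+ (v, x). ennreal ((T_stat ?inv w est \<tau> n s (restrict v K, x))\<^sup>2) \<partial>PVX)
        + ennreal 4 * (\<integral>\<^sup>+ y. ennreal ((D n s y)\<^sup>2) \<partial>?Y)
        + 4 * (\<integral>\<^sup>+ (v1, x). ennreal ((1 / real n * (\<Sum>i\<in>{1..n}. \<integral>(v', x'). w n i v1 x v' x' \<tau> \<partial>PVX)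
            - \<theta> (v1, x))\<^sup>2) \<partial>?Y)"
    if \<theta>: "\<theta> \<in> L2 ?Y" and s: "s \<in> space (?S n)" for \<theta> n s
  proof -
    have [measurable]: "\<theta> \<in> borel_measurable ?Y" using \<theta> by (simp add: L2_def)
    have si: "s i \<in> space ?P" if "i \<in> {1..n}" for i
      using s that by (auto simp: space_PiM)
    define b where "b y = 1 / real n * (\<Sum>i\<in>{1..n}. m n i y) - \<theta> y" for y
    have T_eq: "T_stat ?inv w est \<tau> n s y =
        1 / real n * (\<Sum>i\<in>{1..n}. wb n i (est n s) y (s i) - wb n i \<tau> y (s i))" for y
      unfolding w_bar_eq[symmetric] by (simp add: T_stat_def case_prod_unfold)
    have check_eq: "theta_check ?inv w est n s y = 1 / real n * (\<Sum>i\<in>{1..n}. wb n i (est n s) y (s i))" for y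
      unfolding w_bar_eq[symmetric] by (simp add: theta_check_def case_prod_unfold)
    \<comment> \<open>The averages of wbar_i at \<open>\<tau>\<close> cancel between T_n and D_n,
      the averages of m_i between D_n and b_n.\<close>
    have decomp: "theta_check ?inv w est n s y - \<theta> y = T_stat ?inv w est \<tau> n s y + D n s y + b y" for y
      unfolding T_eq check_eq D_def b_def by (simp add: sum_subtractf right_diff_distrib diff_divide_distrib)
    \<comment> \<open>The sample is fixed here, so \<open>est n s\<close> is a single element of
      \<open>TT\<close>, and only measurability in \<open>y\<close> is at stake.\<close>
    have [measurable]: "T_stat ?inv w est \<tau> n s \<in> borel_measurable ?Y"
      unfolding T_eq[abs_def] by (intro borel_measurable_times borel_measurable_const
          borel_measurable_sum borel_measurable_diff wb_meas' si est[OF s] TT)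
    have [measurable]: "D n s \<in> borel_measurable ?Y"
      unfolding D_def[abs_def] by (intro borel_measurable_times borel_measurable_const
          borel_measurable_sum borel_measurable_diff wb_meas' m_meas si TT)
    have [measurable]: "b \<in> borel_measurable ?Y"
      unfolding b_def[abs_def] by (intro borel_measurable_times borel_measurable_const
          borel_measurable_sum borel_measurable_diff m_meas) measurable
    have "(\<integral>\<^sup>+ (v, x). ennreal ((theta_check ?inv w est n s (restrict v K, x)
         - \<theta> (restrict v K, x))\<^sup>2) \<partial>PVX) =
        (\<integral>\<^sup>+ y. ennreal ((T_stat ?inv w est \<tau> n s y + D n s y + b y)\<^sup>2) \<partial>?Y)"
      unfolding decomp by (rule to_Y) measurable
    also have "\<dots> \<le> 2 * (\<integral>\<^sup>+ y. ennreal ((T_stat ?inv w est \<tau> n s y)\<^sup>2) \<partial>?Y)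
        + 4 * (\<integral>\<^sup>+ y. ennreal ((D n s y)\<^sup>2) \<partial>?Y) + 4 * (\<integral>\<^sup>+ y. ennreal ((b y)\<^sup>2) \<partial>?Y)"
      by (rule nn_integral_sum3_sq_le) measurable
    also have "(\<integral>\<^sup>+ y. ennreal ((T_stat ?inv w est \<tau> n s y)\<^sup>2) \<partial>?Y) =
        (\<integral>\<^sup>+ (v, x). ennreal ((T_stat ?inv w est \<tau> n s (restrict v K, x))\<^sup>2) \<partial>PVX)"
      by (rule to_Y[symmetric]) measurable
    finally show ?thesis
      by (simp only: b_def m_def h_def case_prod_unfold prod.collapse ennreal_numeral)
  qed
  show ?thesis
  proof (intro conjI ballI allI impI)
    fix \<theta> assume \<theta>: "\<theta> \<in> L2 ?Y"
    show "\<exists>A B. stoch_O ?S A (\<lambda>n. ennreal ((a n)\<^sup>2)) \<and>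
        stoch_O ?S B (\<lambda>n. ennreal (1 / (real n)\<^sup>2) *
          (\<Sum>i\<in>{1..n}. \<integral>\<^sup>+ y. sigma_bar_sq ?inv w ?P \<tau> n i y \<partial>?Y)) \<and>
        (\<forall>n\<ge>1. \<forall>s \<in> space (?S n).
          (\<integral>\<^sup>+ (v, x). ennreal ((theta_check ?inv w est n s (restrict v K, x)
             - \<theta> (restrict v K, x))\<^sup>2) \<partial>PVX)
          \<le> A n s + B n s + 4 * (\<integral>\<^sup>+ (v1, x). ennreal ((1 / real n *
              (\<Sum>i\<in>{1..n}. \<integral>(v', x'). w n i v1 x v' x' \<tau> \<partial>PVX) - \<theta> (v1, x))\<^sup>2) \<partial>?Y))"
      \<comment> \<open>The witnesses stay schematic until the two applications of
        \<open>stoch_O_cmult\<close> instantiate them; \<open>bound\<close> then fits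
        literally.\<close>
      by (intro exI conjI allI impI ballI, rule stoch_O_cmult[where c = 2, OF assms(9) zero_less_numeral],
          rule stoch_O_cmult[where c = 4, OF stoch_D zero_less_numeral], rule bound[OF \<theta>])
  next
    fix \<alpha> Qbar v1 x and n i :: nat
    assume delta: "delta_mech XS ZS Q \<alpha> Qbar" and i: "i \<in> {1..n}"
      and v1: "v1 \<in> space (PiM K M)" and x: "x \<in> space XS"
    have "(v1, x) \<in> space ?Y" using v1 x by (simp add: space_Y)
    from ext_variance_mech_inverse_le[OF psi delta h_meas'[OF i TT this]]
    show "sigma_bar_sq ?inv w ?P \<tau> n i (v1, x) \<le> ennreal (4 / \<alpha>\<^sup>2) *
        (\<integral>\<^sup>+ (v, z). ennreal ((w n i v1 x v z \<tau>)\<^sup>2) \<partial>?P)"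
      unfolding sigma_eq wb_def by (simp add: h_def case_prod_unfold)
  qed
qed

end
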